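(* Let $\Bbbk$ be a field, $n\geqslant 1$, and let $\mathcal{P}=(p_{ij})$ be an $n\times n$ matrix with entries in $\Bbbk^{\times}$ such that $p_{ij}p_{ji}=1$ for all $1\leqslant i,j\leqslant n$ and $p_{ii}=1$ for all $i$. Then the skew polynomial ring $S_{\mathcal P}=\Bbbk_{\mathcal P}[x_1,\dots,x_n]$ is a noetherian unique factorization ring.
   Context: The skew polynomial ring $S_{\mathcal{P}}=\Bbbk_{\mathcal{P}}[x_1,\dots,x_n]$ is the $\Bbbk$-algebra generated by $x_1,\dots,x_n$ subject to the relations $x_jx_i=p_{ij}x_ix_j$ for all $1\leqslant i,j\leqslant n$. "Noetherian" means left and right noetherian. An element $a$ of a ring $A$ is normal if $Aa=aA$. An ideal is principal if it is generated by a normal element. A ring $A$ is a noetherian unique factorization ring (noetherian UFR) if $A$ is a noetherian prime ring such that every nonzero prime ideal of $A$ contains a nonzero principal prime ideal. *)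

theory Defs
  imports "HOL-Algebra.QuotRing" "HOL-Algebra.Ideal_Product" "HOL-Algebra.Ring_Divisibility"
begin

section \<open>Noncommutative ring theory\<close>

text \<open>
  The library's \<^const>\<open>primeideal\<close>, \<^const>\<open>principalideal\<close> and \<^const>\<open>noetherian_ring\<close> are the
  commutative (or two-sided) notions, so their one-sided and noncommutative versions are defined here.
  The library's \<^const>\<open>ideal\<close> and \<^const>\<open>genideal\<close> are two-sided and do not assume
  commutativity.
\<close>

locale left_ideal = additive_subgroup I R + ring R for I and R (structure) +
  assumes left_closed: "\<lbrakk>a \<in> I; x \<in> carrier R\<rbrakk> \<Longrightarrow> x \<otimes> a \<in> I"

locale right_ideal = additive_subgroup I R + ring R for I and R (structure) +
  assumes right_closed: "\<lbrakk>a \<in> I; x \<in> carrier R\<rbrakk> \<Longrightarrow> a \<otimes> x \<in> I"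

definition left_span :: "('a, 'm) ring_scheme \<Rightarrow> 'a set \<Rightarrow> 'a set"
  where "left_span R A = \<Inter>{I. left_ideal I R \<and> A \<subseteq> I}"

definition right_span :: "('a, 'm) ring_scheme \<Rightarrow> 'a set \<Rightarrow> 'a set"
  where "right_span R A = \<Inter>{I. right_ideal I R \<and> A \<subseteq> I}"

locale lr_noetherian_ring = ring R for R (structure) +
  assumes left_fin_gen:
      "left_ideal I R \<Longrightarrow> \<exists>A \<subseteq> carrier R. finite A \<and> I = left_span R A"
    and right_fin_gen:
      "right_ideal I R \<Longrightarrow> \<exists>A \<subseteq> carrier R. finite A \<and> I = right_span R A"

locale nc_prime_ideal = ideal P R for P and R (structure) +
  assumes proper: "P \<noteq> carrier R"
    and prime: "\<lbrakk>ideal I R; ideal J R; I \<cdot> J \<subseteq> P\<rbrakk> \<Longrightarrow> I \<subseteq> P \<or> J \<subseteq> P"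

definition nc_prime_ring :: "('a, 'm) ring_scheme \<Rightarrow> bool"
  where "nc_prime_ring R \<longleftrightarrow> ring R \<and> nc_prime_ideal {\<zero>\<^bsub>R\<^esub>} R"

text \<open>The multiplicative cosets \<open>R #> a\<close> and \<open>a <# R\<close> are the sets \<open>Ra\<close> and \<open>aR\<close>.\<close>

definition normal_element :: "('a, 'm) ring_scheme \<Rightarrow> 'a \<Rightarrow> bool"
  where "normal_element R a \<longleftrightarrow>
    a \<in> carrier R \<and> carrier R #>\<^bsub>R\<^esub> a = a <#\<^bsub>R\<^esub> carrier R"

definition normal_principal :: "('a, 'm) ring_scheme \<Rightarrow> 'a set \<Rightarrow> bool"
  where "normal_principal R I \<longleftrightarrow> (\<exists>a. normal_element R a \<and> I = Idl\<^bsub>R\<^esub> {a})"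

definition noetherian_UFR :: "('a, 'm) ring_scheme \<Rightarrow> bool"
  where "noetherian_UFR R \<longleftrightarrow>
    lr_noetherian_ring R \<and> nc_prime_ring R \<and>
    (\<forall>P. nc_prime_ideal P R \<and> P \<noteq> {\<zero>\<^bsub>R\<^esub>} \<longrightarrow>
      (\<exists>Q. nc_prime_ideal Q R \<and> normal_principal R Q \<and> Q \<noteq> {\<zero>\<^bsub>R\<^esub>} \<and> Q \<subseteq> P))"


section \<open>Skew polynomial rings\<close>

text \<open>
  The free algebra on a set \<open>X\<close> over a field: an element is the finitely supported function
  sending a word in \<open>X\<close> to its coefficient, and multiplication is convolution over all ways of
  cutting a word in two.
\<close>

definition free_algebra :: "'x set \<Rightarrow> ('x list \<Rightarrow> 'k::field) ring"
  where "free_algebra X =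
    \<lparr>carrier = {f. finite {w. f w \<noteq> 0} \<and> {w. f w \<noteq> 0} \<subseteq> lists X},
     monoid.mult = (\<lambda>f g w. \<Sum>i\<le>length w. f (take i w) * g (drop i w)),
     one = (\<lambda>w. if w = [] then 1 else 0),
     zero = (\<lambda>w. 0),
     add = (\<lambda>f g w. f w + g w)\<rparr>"

definition free_var :: "'x \<Rightarrow> 'x list \<Rightarrow> 'k::field"
  where "free_var x = (\<lambda>w. if w = [x] then 1 else 0)"

definition free_const :: "'k \<Rightarrow> 'x list \<Rightarrow> 'k::field"
  where "free_const c = (\<lambda>w. if w = [] then c else 0)"

definition skew_relations :: "nat \<Rightarrow> (nat \<Rightarrow> nat \<Rightarrow> 'k::field) \<Rightarrow> (nat list \<Rightarrow> 'k) set"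
  where "skew_relations n p =
    (let F = free_algebra {1..n} in
      {free_var j \<otimes>\<^bsub>F\<^esub> free_var i
          \<ominus>\<^bsub>F\<^esub> free_const (p i j) \<otimes>\<^bsub>F\<^esub> (free_var i \<otimes>\<^bsub>F\<^esub> free_var j)
        | i j. i \<in> {1..n} \<and> j \<in> {1..n}})"

text \<open>Only the entries \<open>p i j\<close> with \<open>1 \<le> i, j \<le> n\<close> matter.\<close>

definition skew_polynomial_ring ::
    "nat \<Rightarrow> (nat \<Rightarrow> nat \<Rightarrow> 'k::field) \<Rightarrow> (nat list \<Rightarrow> 'k) set ring"
  where "skew_polynomial_ring n p =
    (let F = free_algebra {1..n} in F Quot (Idl\<^bsub>F\<^esub> (skew_relations n p)))"

end

theory Submission
  imports Defs "HOL-Library.Poly_Mapping"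
begin

text \<open>
  A skew polynomial ring has the ordered monomials \<open>x\<^sup>a\<close> as a basis, multiplied
  by \<open>x\<^sup>a x\<^sup>b = q(a,b) x\<^sup>a\<^sup>+\<^sup>b\<close> with a bicharacter
  \<open>q\<close>. It is therefore modelled by finitely supported functions on exponent vectors
  with this twisted product, and the presentation by generators and relations is shown to give the
  same ring: modulo the relations every word is a scalar multiple of a sorted word, and the sorted
  words are sent to linearly independent elements (\<open>eval_words_kernel_sorted\<close>,
  \<open>eval_words_kernel\<close>). The property is then carried over by
  \<open>noetherian_UFR_iso\<close>.

  Leading exponents for the lexicographic order add up in products. Hence the ring is a domain,
  and with Dickson's lemma every left or right ideal is finitely generated
  (\<open>lr_noetherian_qring\<close>).

  For the prime ideals, grade the ring by the characters through which the monomials commute with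
  each other. Homogeneous elements are normal. An ideal that contains \<open>g\<close> contains
  \<open>X g - c g X\<close> for all monomials \<open>X\<close> and scalars \<open>c\<close>; this
  suffices to isolate homogeneous elements (\<open>homogeneous_outside\<close>), and in particular
  a nonzero ideal contains a nonzero homogeneous element. Let \<open>P\<close> be a nonzero prime
  ideal. If it contains a variable \<open>x\<^sub>v\<close>, then \<open>(x\<^sub>v)\<close> is
  the required prime ideal. Otherwise let \<open>f\<close> be a nonzero homogeneous element of
  least total degree in \<open>P\<close>. It is irreducible, because for homogeneous
  \<open>g\<close> and \<open>h\<close> with \<open>g h \<in> P\<close> one of the two lies in
  \<open>P\<close>. No variable divides it, since \<open>f\<close> would be a multiple of that
  variable by a scalar. So monomials can be cancelled modulo \<open>f\<close>, and
  \<open>homogeneous_outside\<close> reduces the primeness of \<open>(f)\<close> to products of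
  homogeneous elements.

  What remains is that irreducible homogeneous elements are prime among homogeneous elements
  (\<open>irreducible_imp_prime\<close>). Homogeneous elements commute up to scalars, so the proof
  that a polynomial ring over a factorial ring is factorial goes through: adjoin one variable at a
  time, use pseudo-division in that variable and Gauss's lemma (\<open>primitive_cancel\<close>).
  Working with homogeneous elements of the ring itself avoids the passage to the quantum torus and
  its centre.
\<close>

section \<open>Finitely supported functions\<close>

abbreviation keys where "keys \<equiv> Poly_Mapping.keys"
abbreviation lookup where "lookup \<equiv> Poly_Mapping.lookup"
abbreviation single where "single \<equiv> Poly_Mapping.single"

lemma single_sum_keys: "f = (\<Sum>a\<in>keys f. single a (lookup f a))"
  by (rule poly_mapping_eqI)
    (simp add: lookup_sum lookup_single when_def, simp add: in_keys_iff)

lift_definition restr :: "('m \<Rightarrow> bool) \<Rightarrow> ('m \<Rightarrow>\<^sub>0 'k::zero) \<Rightarrow> ('m \<Rightarrow>\<^sub>0 'k)"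
  is "\<lambda>P f a. if P a then f a else 0"
  by (erule rev_finite_subset) (auto split: if_splits)

lemma lookup_restr: "lookup (restr P f) a = (if P a then lookup f a else 0)"
  by transfer simp

lemma keys_restr: "keys (restr P f) = {a \<in> keys f. P a}"
  by (auto simp: in_keys_iff lookup_restr split: if_splits)

lemma restr_add: "restr P (f + g) = restr P f + restr P (g :: 'm \<Rightarrow>\<^sub>0 'k::comm_monoid_add)"
  by (rule poly_mapping_eqI) (simp add: lookup_restr lookup_add)

lemma restr_zero [simp]: "restr P 0 = 0"
  by (rule poly_mapping_eqI) (simp add: lookup_restr)

lemma restr_sum: "restr P (sum f A) = (\<Sum>x\<in>A. restr P (f x :: 'm \<Rightarrow>\<^sub>0 'k::comm_monoid_add))"
  by (induction A rule: infinite_finite_induct) (simp_all add: restr_add)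

lemma restr_single: "restr P (single a c) = (if P a then single a c else 0)"
  by (rule poly_mapping_eqI) (simp add: lookup_restr lookup_single when_def)

lemma restr_id: "(\<And>a. a \<in> keys f \<Longrightarrow> P a) \<Longrightarrow> restr P f = f"
  by (rule poly_mapping_eqI) (auto simp: lookup_restr in_keys_iff)

lemma restr_eq_0_iff: "restr P f = 0 \<longleftrightarrow> (\<forall>a\<in>keys f. \<not> P a)"
  by (simp only: keys_eq_empty[symmetric] poly_mapping_eq_iff fun_eq_iff lookup_restr lookup_zero)
    (auto simp: in_keys_iff)

lemma single_eq_0_iff [simp]: "single a c = 0 \<longleftrightarrow> c = 0"
  by (simp flip: keys_eq_empty)

lemma ex_key: "f \<noteq> 0 \<Longrightarrow> \<exists>a. a \<in> keys f"
  by (metis in_keys_iff lookup_zero poly_mapping_eqI)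

section \<open>Twisted monoid algebras\<close>

locale skew_monoid_algebra =
  fixes q :: "'m::{ordered_cancel_comm_monoid_add, linorder} \<Rightarrow> 'm \<Rightarrow> 'k::field"
  assumes q_add_left: "q (a + b) c = q a c * q b c"
    and q_add_right: "q a (b + c) = q a b * q a c"
    and q_nonzero [simp]: "q a b \<noteq> 0"
begin

definition tmul :: "('m \<Rightarrow>\<^sub>0 'k) \<Rightarrow> ('m \<Rightarrow>\<^sub>0 'k) \<Rightarrow> ('m \<Rightarrow>\<^sub>0 'k)" (infixl "\<star>" 70)
  where "f \<star> g = (\<Sum>a\<in>keys f. \<Sum>b\<in>keys g.
    single (a + b) (q a b * lookup f a * lookup g b))"

lemma q_zero_left [simp]: "q 0 b = 1"
  using q_add_left[of 0 0 b] by simp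

lemma q_zero_right [simp]: "q b 0 = 1"
  using q_add_right[of b 0 0] by simp

lemma tmul_superset:
  assumes "finite A" "keys f \<subseteq> A" "finite B" "keys g \<subseteq> B"
  shows "f \<star> g = (\<Sum>a\<in>A. \<Sum>b\<in>B. single (a + b) (q a b * lookup f a * lookup g b))"
proof -
  have "f \<star> g = (\<Sum>a\<in>A. \<Sum>b\<in>keys g. single (a + b) (q a b * lookup f a * lookup g b))"
    unfolding tmul_def using assms
    by (intro sum.mono_neutral_left) (auto simp: in_keys_iff)
  also have "\<dots> = (\<Sum>a\<in>A. \<Sum>b\<in>B. single (a + b) (q a b * lookup f a * lookup g b))"
    using assms by (intro sum.cong refl sum.mono_neutral_left) (auto simp: in_keys_iff)
  finally show ?thesis .
qed

lemma tmul_zero_left [simp]: "0 \<star> f = 0"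
  by (simp add: tmul_def)

lemma tmul_zero_right [simp]: "f \<star> 0 = 0"
  by (simp add: tmul_def)

lemma tmul_distrib_right: "(f + g) \<star> h = f \<star> h + g \<star> h"
proof -
  let ?A = "keys f \<union> keys g"
  have "keys (f + g) \<subseteq> ?A"
    by (rule keys_add)
  then show ?thesis
    by (simp add: tmul_superset[of ?A _ "keys h"] lookup_add sum.distrib ring_distribs single_add)
qed

lemma tmul_distrib_left: "h \<star> (f + g) = h \<star> f + h \<star> g"
proof -
  let ?A = "keys f \<union> keys g"
  have "keys (f + g) \<subseteq> ?A"
    by (rule keys_add)
  then show ?thesis
    by (simp add: tmul_superset[of "keys h" _ ?A] lookup_add sum.distrib ring_distribs single_add)
qed

lemma tmul_uminus_left: "(- f) \<star> g = - (f \<star> g)"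
  by (metis add.inverse_unique ab_left_minus add.commute tmul_distrib_right tmul_zero_left)

lemma tmul_uminus_right: "f \<star> (- g) = - (f \<star> g)"
  by (metis add.inverse_unique ab_left_minus add.commute tmul_distrib_left tmul_zero_right)

lemma tmul_diff_left: "(f - g) \<star> h = f \<star> h - g \<star> h"
  by (metis add_uminus_conv_diff tmul_distrib_right tmul_uminus_left)

lemma tmul_diff_right: "h \<star> (f - g) = h \<star> f - h \<star> g"
  by (metis add_uminus_conv_diff tmul_distrib_left tmul_uminus_right)

lemma tmul_sum_left: "sum f A \<star> g = (\<Sum>x\<in>A. f x \<star> g)"
  by (induction A rule: infinite_finite_induct) (simp_all add: tmul_distrib_right)

lemma tmul_sum_right: "g \<star> sum f A = (\<Sum>x\<in>A. g \<star> f x)"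
  by (induction A rule: infinite_finite_induct) (simp_all add: tmul_distrib_left)

lemma tmul_single_single:
  "single a x \<star> single b y = single (a + b) (q a b * x * y)"
  by (simp add: tmul_superset[of "{a}" _ "{b}"])

lemma tmul_assoc: "f \<star> g \<star> h = f \<star> (g \<star> h)"
proof -
  let ?s = "\<lambda>f a. single a (lookup f a)"
  have single: "single a x \<star> single b y \<star> single c z =
      single a x \<star> (single b y \<star> single c z)" for a b c x y z
    by (simp add: tmul_single_single q_add_left q_add_right ac_simps)
  have "f \<star> g \<star> h = (\<Sum>a\<in>keys f. ?s f a) \<star> (\<Sum>b\<in>keys g. ?s g b) \<star> (\<Sum>c\<in>keys h. ?s h c)"
    by (simp only: single_sum_keys[symmetric])
  also have "\<dots> = (\<Sum>a\<in>keys f. ?s f a) \<star> ((\<Sum>b\<in>keys g. ?s g b) \<star> (\<Sum>c\<in>keys h. ?s h c))"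
    by (simp only: tmul_sum_left tmul_sum_right single)
  also have "\<dots> = f \<star> (g \<star> h)"
    by (simp only: single_sum_keys[symmetric])
  finally show ?thesis .
qed

lemma keys_tmul: "keys (f \<star> g) \<subseteq> {a + b |a b. a \<in> keys f \<and> b \<in> keys g}"
proof
  fix c assume "c \<in> keys (f \<star> g)"
  then have "(\<Sum>a\<in>keys f. \<Sum>b\<in>keys g. lookup (single (a + b) (q a b * lookup f a * lookup g b)) c) \<noteq> 0"
    by (simp add: tmul_def in_keys_iff lookup_sum)
  then obtain a b where "a \<in> keys f" "b \<in> keys g"
      "lookup (single (a + b) (q a b * lookup f a * lookup g b)) c \<noteq> 0"
    by (metis (no_types, lifting) sum.not_neutral_contains_not_neutral)
  then show "c \<in> {a + b |a b. a \<in> keys f \<and> b \<in> keys g}"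
    by (auto simp: lookup_single when_def split: if_splits)
qed

lemma one_tmul [simp]: "1 \<star> f = f"
proof -
  have "1 \<star> f = (\<Sum>b\<in>keys f. single b (lookup f b))"
    by (simp add: tmul_superset[of "{0}" _ "keys f"])
  then show ?thesis by (simp only: single_sum_keys[symmetric])
qed

lemma tmul_one [simp]: "f \<star> 1 = f"
proof -
  have "f \<star> 1 = (\<Sum>b\<in>keys f. single b (lookup f b))"
    by (simp add: tmul_superset[of "keys f" _ "{0}"])
  then show ?thesis by (simp only: single_sum_keys[symmetric])
qed

lemma lookup_tmul_single_right:
  "lookup (f \<star> single b y) (a + b) = q a b * lookup f a * y"
  by (simp add: tmul_superset[of "keys f" _ "{b}"] lookup_sum lookup_single when_def in_keys_iff)

lemma lookup_tmul_single_left: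
  "lookup (single b y \<star> f) (b + a) = q b a * y * lookup f a"
  by (simp add: tmul_superset[of "{b}" _ "keys f"] lookup_sum lookup_single when_def in_keys_iff)

lemma lookup_scalar [simp]: "lookup (single 0 c \<star> f) a = c * lookup f a"
  using lookup_tmul_single_left[of 0 c f a] by simp

lemma scalar_commute: "f \<star> single 0 c = single 0 c \<star> f"
proof (rule poly_mapping_eqI)
  fix a show "lookup (f \<star> single 0 c) a = lookup (single 0 c \<star> f) a"
    using lookup_tmul_single_right[of f 0 c a] by simp
qed

lemma keys_scalar: "c \<noteq> 0 \<Longrightarrow> keys (single 0 c \<star> f) = keys f"
  by (auto simp: in_keys_iff)

lemma scalar_scalar:
  "single 0 c \<star> (single 0 d \<star> f) = single 0 (c * d) \<star> f"
  by (simp add: tmul_assoc[symmetric] tmul_single_single)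

lemma keys_tmul_single:
  assumes "y \<noteq> 0"
  shows "keys (f \<star> single b y) = (\<lambda>a. a + b) ` keys f"
proof
  show "keys (f \<star> single b y) \<subseteq> (\<lambda>a. a + b) ` keys f"
    using keys_tmul[of f "single b y"] by (auto split: if_splits)
  show "(\<lambda>a. a + b) ` keys f \<subseteq> keys (f \<star> single b y)"
    using assms by (auto simp: in_keys_iff lookup_tmul_single_right)
qed

text \<open>
  A condition on exponents that factors through the two summands picks out of a product exactly
  the product of the parts that it picks out of the factors. Suitable conditions turn this into
  statements on leading coefficients, on top-degree parts, on graded components and on the terms
  that do not involve a given variable.
\<close>
lemma restr_tmul:
  assumes "\<And>a b. a \<in> keys f \<Longrightarrow> b \<in> keys g \<Longrightarrow> P (a + b) \<longleftrightarrow> Q a \<and> R b"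
  shows "restr P (f \<star> g) = restr Q f \<star> restr R g"
proof -
  have "restr P (f \<star> g) = (\<Sum>a\<in>keys f. \<Sum>b\<in>keys g. if P (a + b) then
      single (a + b) (q a b * lookup f a * lookup g b) else 0)"
    by (simp add: tmul_def restr_sum restr_single)
  also have "\<dots> = (\<Sum>a\<in>keys f. \<Sum>b\<in>keys g.
      single (a + b) (q a b * lookup (restr Q f) a * lookup (restr R g) b))"
    using assms by (intro sum.cong refl) (auto simp: lookup_restr)
  also have "\<dots> = restr Q f \<star> restr R g"
    by (rule tmul_superset[symmetric]) (auto simp: keys_restr)
  finally show ?thesis .
qed

text \<open>
  The leading exponent. For exponent vectors the order is the lexicographic one.
\<close>
definition lm :: "('m \<Rightarrow>\<^sub>0 'k) \<Rightarrow> 'm"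
  where "lm f = Max (keys f)"

lemma lm_in_keys: "f \<noteq> 0 \<Longrightarrow> lm f \<in> keys f"
  unfolding lm_def by (rule Max_in) (use ex_key in auto)

lemma le_lm: "a \<in> keys f \<Longrightarrow> a \<le> lm f"
  unfolding lm_def by simp

text \<open>
  The largest exponent of a product arises from only one pair of terms, since addition of
  exponents is strictly monotone. So nothing cancels there, and the algebra is a domain.
\<close>
lemma lookup_lm_tmul:
  "lookup (f \<star> g) (lm f + lm g) = q (lm f) (lm g) * lookup f (lm f) * lookup g (lm g)"
proof -
  have "restr (\<lambda>c. c = lm f + lm g) (f \<star> g) = restr (\<lambda>a. a = lm f) f \<star> restr (\<lambda>b. b = lm g) g"
  proof (rule restr_tmul)
    fix a b assume "a \<in> keys f" "b \<in> keys g"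
    then have "a \<le> lm f" "b \<le> lm g" by (auto intro: le_lm)
    then have "a = lm f \<and> b = lm g" if "a + b = lm f + lm g"
      using that add_less_le_mono[of a "lm f" b "lm g"] add_le_less_mono[of a "lm f" b "lm g"]
      by (auto simp: order_le_less)
    then show "a + b = lm f + lm g \<longleftrightarrow> a = lm f \<and> b = lm g"
      by blast
  qed
  also have "\<dots> = single (lm f) (lookup f (lm f)) \<star> single (lm g) (lookup g (lm g))"
    by (intro arg_cong2[of _ _ _ _ tmul] poly_mapping_eqI)
      (auto simp: lookup_restr lookup_single when_def)
  finally have "lookup (restr (\<lambda>c. c = lm f + lm g) (f \<star> g)) (lm f + lm g)
      = lookup (single (lm f) (lookup f (lm f)) \<star> single (lm g) (lookup g (lm g))) (lm f + lm g)"
    by simp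
  then show ?thesis
    by (simp add: lookup_restr tmul_single_single)
qed

lemma tmul_eq_0_iff [simp]: "f \<star> g = 0 \<longleftrightarrow> f = 0 \<or> g = 0"
proof
  assume "f \<star> g = 0"
  then have "q (lm f) (lm g) * lookup f (lm f) * lookup g (lm g) = 0"
    using lookup_lm_tmul[of f g] by simp
  then show "f = 0 \<or> g = 0"
    using lm_in_keys[of f] lm_in_keys[of g] by (auto simp: in_keys_iff)
qed auto

lemma tmul_left_cancel: "f \<noteq> 0 \<Longrightarrow> f \<star> g = f \<star> h \<longleftrightarrow> g = h"
  by (metis right_minus_eq tmul_diff_right tmul_eq_0_iff)

lemma tmul_right_cancel: "f \<noteq> 0 \<Longrightarrow> g \<star> f = h \<star> f \<longleftrightarrow> g = h"
  by (metis right_minus_eq tmul_diff_left tmul_eq_0_iff)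

lemma lm_tmul:
  assumes "f \<noteq> 0" "g \<noteq> 0"
  shows "lm (f \<star> g) = lm f + lm g"
proof (rule antisym)
  have "f \<star> g \<noteq> 0" using assms by simp
  then have "lm (f \<star> g) \<in> keys (f \<star> g)" by (rule lm_in_keys)
  then obtain a b where "a \<in> keys f" "b \<in> keys g" "lm (f \<star> g) = a + b"
    using keys_tmul by blast
  then show "lm (f \<star> g) \<le> lm f + lm g"
    by (simp add: add_mono le_lm)
  show "lm f + lm g \<le> lm (f \<star> g)"
    using assms lm_in_keys[of f] lm_in_keys[of g]
    by (intro le_lm) (simp add: in_keys_iff lookup_lm_tmul)
qed

text \<open>
  With 0 inserted, the zero element has degree 0.
\<close>
definition weighted_degree :: "('m \<Rightarrow> nat) \<Rightarrow> ('m \<Rightarrow>\<^sub>0 'k) \<Rightarrow> nat"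
  where "weighted_degree w f = Max (insert 0 (w ` keys f))"

lemma le_weighted_degree: "a \<in> keys f \<Longrightarrow> w a \<le> weighted_degree w f"
  by (auto simp: weighted_degree_def intro!: Max_ge)

lemma weighted_degree_attained: "f \<noteq> 0 \<Longrightarrow> \<exists>a\<in>keys f. w a = weighted_degree w f"
proof -
  assume "f \<noteq> 0"
  then obtain a where a: "a \<in> keys f" using ex_key by blast
  have "weighted_degree w f \<in> insert 0 (w ` keys f)"
    unfolding weighted_degree_def by (rule Max_in) auto
  then show ?thesis
    using a le_weighted_degree[OF a, of w] by (metis imageE insertE le_zero_eq)
qed

lemma weighted_degree_le_iff: "weighted_degree w f \<le> d \<longleftrightarrow> (\<forall>a\<in>keys f. w a \<le> d)"
  by (simp add: weighted_degree_def)

definition top_part :: "('m \<Rightarrow> nat) \<Rightarrow> ('m \<Rightarrow>\<^sub>0 'k) \<Rightarrow> ('m \<Rightarrow>\<^sub>0 'k)"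
  where "top_part w f = restr (\<lambda>a. w a = weighted_degree w f) f"

lemma top_part_nonzero: "f \<noteq> 0 \<Longrightarrow> top_part w f \<noteq> 0"
  using weighted_degree_attained by (auto simp: top_part_def restr_eq_0_iff)

lemma restr_top_tmul:
  assumes "\<And>a b. w (a + b) = w a + w b"
  shows "restr (\<lambda>c. w c = weighted_degree w f + weighted_degree w g) (f \<star> g) = top_part w f \<star> top_part w g"
  unfolding top_part_def
proof (rule restr_tmul)
  fix a b assume "a \<in> keys f" "b \<in> keys g"
  then have "w a \<le> weighted_degree w f" "w b \<le> weighted_degree w g" by (auto intro: le_weighted_degree)
  then show "w (a + b) = weighted_degree w f + weighted_degree w g \<longleftrightarrow> w a = weighted_degree w f \<and> w b = weighted_degree w g"
    by (auto simp: assms)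
qed

text \<open>
  The top-degree part of a product is the product of the top-degree parts, which is nonzero in a
  domain.
\<close>
lemma weighted_degree_tmul:
  assumes w: "\<And>a b. w (a + b) = w a + w b" and nz: "f \<noteq> 0" "g \<noteq> 0"
  shows "weighted_degree w (f \<star> g) = weighted_degree w f + weighted_degree w g"
proof (rule antisym)
  show "weighted_degree w (f \<star> g) \<le> weighted_degree w f + weighted_degree w g"
    using keys_tmul[of f g] by (fastforce simp: weighted_degree_le_iff w intro: add_mono le_weighted_degree)
  have "restr (\<lambda>c. w c = weighted_degree w f + weighted_degree w g) (f \<star> g) \<noteq> 0"
    by (simp add: restr_top_tmul[OF w] top_part_nonzero nz)
  then show "weighted_degree w f + weighted_degree w g \<le> weighted_degree w (f \<star> g)"
    by (auto simp: restr_eq_0_iff dest: le_weighted_degree[of _ _ w])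
qed

section \<open>Commutation characters and homogeneous elements\<close>

text \<open>
  Monomials commute up to a scalar: \<open>x\<^sup>a x\<^sup>b = comm_factor a b x\<^sup>b
  x\<^sup>a\<close>.
\<close>
definition comm_factor :: "'m \<Rightarrow> 'm \<Rightarrow> 'k"
  where "comm_factor a b = q a b / q b a"

lemma comm_factor_nonzero [simp]: "comm_factor a b \<noteq> 0"
  by (simp add: comm_factor_def)

lemma comm_factor_add_left: "comm_factor (a + b) c = comm_factor a c * comm_factor b c"
  by (simp add: comm_factor_def q_add_left q_add_right)

lemma comm_factor_swap: "comm_factor a b = 1 / comm_factor b a"
  by (simp add: comm_factor_def)

definition same_character :: "'m \<Rightarrow> 'm \<Rightarrow> bool"
  where "same_character a b \<longleftrightarrow> (\<forall>c. comm_factor a c = comm_factor b c)"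

lemma same_character_refl [simp]: "same_character a a" and same_character_sym: "same_character a b \<Longrightarrow> same_character b a"
  and same_character_trans: "same_character a b \<Longrightarrow> same_character b c \<Longrightarrow> same_character a c"
  by (auto simp: same_character_def)

lemma same_character_add_left_iff [simp]: "same_character (a + b) (a + c) \<longleftrightarrow> same_character b c"
  by (simp add: same_character_def comm_factor_add_left)

lemma same_character_add_right_iff [simp]: "same_character (b + a) (c + a) \<longleftrightarrow> same_character b c"
  by (simp add: same_character_def comm_factor_add_left)

lemma same_character_add: "same_character a b \<Longrightarrow> same_character c d \<Longrightarrow> same_character (a + c) (b + d)"
  by (simp add: same_character_def comm_factor_add_left)

text \<open>
  Sending an exponent to its commutation character \<open>comm_factor a\<close> grades the algebra
  by the group of characters, and these are the homogeneous elements of that grading. Conjugation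
  by a monomial multiplies such an element by a scalar; this is why they are normal, and why they
  commute with each other up to scalars.
\<close>
definition homogeneous :: "('m \<Rightarrow>\<^sub>0 'k) \<Rightarrow> bool"
  where "homogeneous f \<longleftrightarrow> (\<forall>a\<in>keys f. \<forall>b\<in>keys f. same_character a b)"

lemma homogeneous_subset: "homogeneous f \<Longrightarrow> keys g \<subseteq> keys f \<Longrightarrow> homogeneous g"
  by (auto simp: homogeneous_def)

lemma homogeneous_single [simp]: "homogeneous (single a c)"
  by (simp add: homogeneous_def)

lemma homogeneous_one [simp]: "homogeneous 1"
  by (simp add: homogeneous_def)

lemma homogeneous_restr: "homogeneous f \<Longrightarrow> homogeneous (restr P f)"
  by (rule homogeneous_subset) (auto simp: keys_restr)

lemma homogeneous_tmul: "homogeneous f \<Longrightarrow> homogeneous g \<Longrightarrow> homogeneous (f \<star> g)"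
  using keys_tmul[of f g] unfolding homogeneous_def by (blast intro: same_character_add)

text \<open>
  To move \<open>f\<close> past the term \<open>x\<^sup>b\<close> costs the same scalar for every
  term of \<open>f\<close>, so only the coefficients of \<open>u\<close> have to be rescaled.
\<close>
lemma homogeneous_normal_left:
  assumes "homogeneous f"
  shows "\<exists>v. keys v = keys u \<and> u \<star> f = f \<star> v"
proof (cases "f = 0")
  case True
  then show ?thesis by auto
next
  case False
  then obtain d where d: "d \<in> keys f" using ex_key by blast
  define v where "v = Poly_Mapping.mapp (\<lambda>b x. comm_factor b d * x) u"
  have v: "lookup v b = comm_factor b d * lookup u b" for b
    by (simp add: v_def lookup_mapp when_def in_keys_iff)
  then have kv: "keys v = keys u"
    by (auto simp: in_keys_iff)
  have "u \<star> f = (\<Sum>b\<in>keys u. \<Sum>a\<in>keys f. single (b + a) (q b a * lookup u b * lookup f a))"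
    by (simp add: tmul_def)
  also have "\<dots> = (\<Sum>b\<in>keys u. \<Sum>a\<in>keys f. single (a + b) (q a b * lookup f a * lookup v b))"
  proof (intro sum.cong refl)
    fix a b assume "a \<in> keys f"
    then have "same_character a d" using assms d by (simp add: homogeneous_def)
    then have "comm_factor b d = comm_factor b a"
      by (simp add: same_character_def comm_factor_swap[of b])
    then show "single (b + a) (q b a * lookup u b * lookup f a) =
        single (a + b) (q a b * lookup f a * lookup v b)"
      by (simp add: v comm_factor_def ac_simps)
  qed
  also have "\<dots> = f \<star> v"
    by (simp add: tmul_def kv) (rule sum.swap)
  finally show ?thesis using kv by blast
qed

lemma homogeneous_normal_right:
  assumes "homogeneous f"
  shows "\<exists>v. keys v = keys u \<and> f \<star> u = v \<star> f"
proof (cases "f = 0")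
  case True
  then show ?thesis by auto
next
  case False
  then obtain d where d: "d \<in> keys f" using ex_key by blast
  define v where "v = Poly_Mapping.mapp (\<lambda>b x. comm_factor d b * x) u"
  have v: "lookup v b = comm_factor d b * lookup u b" for b
    by (simp add: v_def lookup_mapp when_def in_keys_iff)
  then have kv: "keys v = keys u"
    by (auto simp: in_keys_iff)
  have "f \<star> u = (\<Sum>a\<in>keys f. \<Sum>b\<in>keys u. single (a + b) (q a b * lookup f a * lookup u b))"
    by (simp add: tmul_def)
  also have "\<dots> = (\<Sum>a\<in>keys f. \<Sum>b\<in>keys u. single (b + a) (q b a * lookup v b * lookup f a))"
  proof (intro sum.cong refl)
    fix a b assume "a \<in> keys f"
    then have "same_character d a" using assms d by (simp add: homogeneous_def)
    then have "comm_factor d b = comm_factor a b"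
      by (simp add: same_character_def)
    then show "single (a + b) (q a b * lookup f a * lookup u b) =
        single (b + a) (q b a * lookup v b * lookup f a)"
      by (simp add: v comm_factor_def ac_simps)
  qed
  also have "\<dots> = v \<star> f"
    by (simp add: tmul_def kv) (rule sum.swap)
  finally show ?thesis using kv by blast
qed

lemma homogeneous_skew_commute:
  assumes f: "homogeneous f" and g: "homogeneous g"
  shows "\<exists>c. c \<noteq> 0 \<and> f \<star> g = single 0 c \<star> (g \<star> f)"
proof (cases "f = 0 \<or> g = 0")
  case True
  then show ?thesis by (intro exI[of _ 1]) auto
next
  case False
  then obtain d e where d: "d \<in> keys f" "e \<in> keys g" using ex_key by blast
  have "f \<star> g = (\<Sum>a\<in>keys f. \<Sum>b\<in>keys g. single (a + b) (q a b * lookup f a * lookup g b))"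
    by (simp add: tmul_def)
  also have "\<dots> = (\<Sum>a\<in>keys f. \<Sum>b\<in>keys g. single 0 (comm_factor d e) \<star>
      single (b + a) (q b a * lookup g b * lookup f a))"
  proof (intro sum.cong refl)
    fix a b assume ab: "a \<in> keys f" "b \<in> keys g"
    then have "same_character a d" "same_character b e" using f g d by (auto simp: homogeneous_def)
    then have "comm_factor d e = comm_factor a b"
      by (simp add: same_character_def comm_factor_swap[of a])
    then show "single (a + b) (q a b * lookup f a * lookup g b) =
        single 0 (comm_factor d e) \<star> single (b + a) (q b a * lookup g b * lookup f a)"
      by (simp add: tmul_single_single comm_factor_def ac_simps)
  qed
  also have "\<dots> = single 0 (comm_factor d e) \<star> (g \<star> f)"
    by (subst sum.swap) (simp only: tmul_def[of g f] tmul_sum_right)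
  finally show ?thesis using comm_factor_nonzero by blast
qed

text \<open>
  Multiplication by the homogeneous \<open>f\<close> shifts all graded components of
  \<open>s\<close> by the degree of \<open>f\<close> and kills none of them. Two different
  components of \<open>s\<close> would therefore remain visible in the product.
\<close>
lemma homogeneous_cofactor:
  assumes f: "homogeneous f" and s: "homogeneous (f \<star> s)" and "f \<noteq> 0"
  shows "homogeneous s"
  unfolding homogeneous_def
proof (intro ballI)
  fix a b assume a: "a \<in> keys s" and b: "b \<in> keys s"
  obtain d where d: "d \<in> keys f" using \<open>f \<noteq> 0\<close> ex_key by blast
  have component: "\<exists>c \<in> keys (f \<star> s). same_character c (d + x)" if "x \<in> keys s" for x
  proof -
    have "restr (\<lambda>c. same_character c (d + x)) (f \<star> s) = restr (\<lambda>_. True) f \<star> restr (\<lambda>y. same_character y x) s"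
    proof (rule restr_tmul)
      fix a b assume "a \<in> keys f"
      then have "same_character a d" using f d by (simp add: homogeneous_def)
      then have "same_character (a + b) (d + b)" by (simp add: same_character_add)
      then show "same_character (a + b) (d + x) \<longleftrightarrow> True \<and> same_character b x"
        by (metis same_character_add_left_iff same_character_sym same_character_trans)
    qed
    moreover have "restr (\<lambda>_. True) f = f" by (rule restr_id) simp
    moreover have "restr (\<lambda>y. same_character y x) s \<noteq> 0" using that by (auto simp: restr_eq_0_iff intro!: bexI[of _ x])
    ultimately have "restr (\<lambda>c. same_character c (d + x)) (f \<star> s) \<noteq> 0" using \<open>f \<noteq> 0\<close> by simp
    then show ?thesis by (auto simp: restr_eq_0_iff)
  qed
  obtain c c' where "c \<in> keys (f \<star> s)" "same_character c (d + a)" "c' \<in> keys (f \<star> s)" "same_character c' (d + b)"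
    using component a b by blast
  then have "same_character (d + a) (d + b)"
    using s unfolding homogeneous_def by (metis same_character_sym same_character_trans)
  then show "same_character a b" by simp
qed

text \<open>
  The quotient of each term by \<open>x\<^sup>b\<close> has to undo the scalar \<open>q c
  b\<close> that the twisted product introduces.
\<close>
lemma right_factor_monomial:
  assumes "\<And>a. a \<in> keys f \<Longrightarrow> \<exists>c. a = c + b"
  shows "\<exists>l. f = l \<star> single b 1"
proof -
  let ?c = "\<lambda>a. SOME c. a = c + b"
  define l where "l = (\<Sum>a\<in>keys f. single (?c a) (lookup f a / q (?c a) b))"
  have "l \<star> single b 1 = (\<Sum>a\<in>keys f. single a (lookup f a))"
    unfolding l_def tmul_sum_left
  proof (rule sum.cong[OF refl])
    fix a assume "a \<in> keys f"
    then have "a = ?c a + b" using assms by (metis (mono_tags, lifting) someI_ex)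
    then show "single (?c a) (lookup f a / q (?c a) b) \<star> single b 1 =
        single a (lookup f a)"
      by (simp add: tmul_single_single)
  qed
  then show ?thesis by (intro exI[of _ l]) (simp only: single_sum_keys[symmetric])
qed

section \<open>Divisibility\<close>

definition divides :: "('m \<Rightarrow>\<^sub>0 'k) \<Rightarrow> ('m \<Rightarrow>\<^sub>0 'k) \<Rightarrow> bool" (infix "divides" 50)
  where "f divides g \<longleftrightarrow> (\<exists>s. g = f \<star> s)"

lemma divides_refl [simp]: "f divides f"
  unfolding divides_def by (metis tmul_one)

lemma divides_0 [simp]: "f divides 0"
  unfolding divides_def by (metis tmul_zero_right)

lemma divides_tmul_right: "f divides g \<Longrightarrow> f divides g \<star> h"
  unfolding divides_def by (metis tmul_assoc)

lemma divides_tmul_left: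
  assumes "homogeneous f" "f divides g"
  shows "f divides h \<star> g"
proof -
  obtain s where "g = f \<star> s" using assms(2) by (auto simp: divides_def)
  moreover obtain h' where "h \<star> f = f \<star> h'" using homogeneous_normal_left[OF assms(1)] by blast
  ultimately show ?thesis unfolding divides_def by (metis tmul_assoc)
qed

lemma divides_add: "f divides g \<Longrightarrow> f divides h \<Longrightarrow> f divides g + h"
  unfolding divides_def by (metis tmul_distrib_left)

lemma divides_diff: "f divides g \<Longrightarrow> f divides h \<Longrightarrow> f divides g - h"
  unfolding divides_def by (metis tmul_diff_right)

lemma divides_scalar_iff: "c \<noteq> 0 \<Longrightarrow> f divides single 0 c \<star> g \<longleftrightarrow> f divides g"
proof
  assume c: "c \<noteq> 0" and f: "f divides single 0 c \<star> g"
  from f have "f divides single 0 c \<star> g \<star> single 0 (1 / c)" by (rule divides_tmul_right)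
  also have "single 0 c \<star> g \<star> single 0 (1 / c) = g"
    using c by (simp add: scalar_commute[of "single 0 c \<star> g"] scalar_scalar)
  finally show "f divides g" .
next
  assume "f divides g"
  then have "f divides g \<star> single 0 c" by (rule divides_tmul_right)
  then show "f divides single 0 c \<star> g" by (simp add: scalar_commute)
qed

text \<open>
  A common exponent forces the two elements to have the same degree; in general a difference of
  homogeneous elements is not homogeneous.
\<close>
lemma homogeneous_diff:
  assumes "homogeneous f" "homogeneous g" "a \<in> keys f" "a \<in> keys g"
  shows "homogeneous (f - g)"
proof -
  have "same_character b a" if "b \<in> keys (f - g)" for b
  proof -
    have "b \<in> keys f \<or> b \<in> keys g" using that by (auto simp: in_keys_iff lookup_minus)
    then show ?thesis using assms by (auto simp: homogeneous_def)
  qed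
  then show ?thesis unfolding homogeneous_def by (blast intro: same_character_trans same_character_sym)
qed

end

section \<open>Polynomials in finitely many variables\<close>

lemma keys_add_nat: "keys (a + b) = keys a \<union> keys (b :: 'i \<Rightarrow>\<^sub>0 nat)"
  by (auto simp: in_keys_iff lookup_add)

definition exponent_degree :: "('i \<Rightarrow>\<^sub>0 nat) \<Rightarrow> nat"
  where "exponent_degree a = (\<Sum>i\<in>keys a. lookup a i)"

lemma exponent_degree_add: "exponent_degree (a + b) = exponent_degree a + exponent_degree b"
proof -
  have sup: "exponent_degree c = (\<Sum>i\<in>keys (a + b). lookup c i)" if "keys c \<subseteq> keys (a + b)" for c
    unfolding exponent_degree_def using that by (intro sum.mono_neutral_left) (auto simp: in_keys_iff)
  show ?thesis
    using sup[of a] sup[of b] sup[of "a + b"] by (simp add: keys_add_nat lookup_add sum.distrib)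
qed

lemma exponent_degree_eq_0_iff [simp]: "exponent_degree a = 0 \<longleftrightarrow> a = 0"
  by (auto simp: exponent_degree_def in_keys_iff intro: poly_mapping_eqI)

locale quantum_space = skew_monoid_algebra q
  for q :: "(nat \<Rightarrow>\<^sub>0 nat) \<Rightarrow> (nat \<Rightarrow>\<^sub>0 nat) \<Rightarrow> 'k::field"
begin

definition polys :: "nat set \<Rightarrow> ((nat \<Rightarrow>\<^sub>0 nat) \<Rightarrow>\<^sub>0 'k) set"
  where "polys V = {f. \<forall>a\<in>keys f. keys a \<subseteq> V}"

lemma polys_lookup: "f \<in> polys V \<Longrightarrow> a \<in> keys f \<Longrightarrow> v \<notin> V \<Longrightarrow> lookup a v = 0"
  using in_keys_iff[of v a] by (auto simp: polys_def)

lemma polys_subset_keys: "f \<in> polys V \<Longrightarrow> keys g \<subseteq> keys f \<Longrightarrow> g \<in> polys V"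
  by (auto simp: polys_def)

lemma polys_mono: "V \<subseteq> W \<Longrightarrow> polys V \<subseteq> polys W"
  by (auto simp: polys_def)

lemma polys_zero [simp]: "0 \<in> polys V"
  by (simp add: polys_def)

lemma polys_single: "keys a \<subseteq> V \<Longrightarrow> single a c \<in> polys V"
  by (simp add: polys_def)

lemma polys_scalar [simp]: "single 0 c \<in> polys V"
  by (simp add: polys_def)

lemma polys_one [simp]: "1 \<in> polys V"
  by (simp add: polys_def)

lemma polys_add: "f \<in> polys V \<Longrightarrow> g \<in> polys V \<Longrightarrow> f + g \<in> polys V"
  using keys_add[of f g] by (fastforce simp: polys_def)

lemma polys_uminus: "f \<in> polys V \<Longrightarrow> - f \<in> polys V"
  by (simp add: polys_def in_keys_iff)

lemma polys_diff: "f \<in> polys V \<Longrightarrow> g \<in> polys V \<Longrightarrow> f - g \<in> polys V"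
  using polys_add[of f V "- g"] polys_uminus[of g V] by simp

lemma polys_tmul: "f \<in> polys V \<Longrightarrow> g \<in> polys V \<Longrightarrow> f \<star> g \<in> polys V"
  using keys_tmul[of f g] by (fastforce simp: polys_def keys_add_nat)

lemma polys_restr: "f \<in> polys V \<Longrightarrow> restr P f \<in> polys V"
  by (rule polys_subset_keys) (auto simp: keys_restr)

text \<open>
  A variable that does not occur in a product occurs in neither factor, because degrees in a
  single variable add up.
\<close>
lemma polys_factors:
  assumes "f \<star> s \<in> polys V" "f \<noteq> 0" "s \<noteq> 0"
  shows "f \<in> polys V" "s \<in> polys V"
proof -
  have "lookup a v = 0" if "v \<notin> V" "a \<in> keys f \<union> keys s" for a v
  proof -
    let ?w = "\<lambda>a. lookup a v"
    have "weighted_degree ?w (f \<star> s) = 0"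
      proof -
      have "lookup c v = 0" if "c \<in> keys (f \<star> s)" for c
        using polys_lookup assms(1) that \<open>v \<notin> V\<close> by blast
      then show ?thesis using weighted_degree_le_iff[of ?w "f \<star> s" 0] by auto
    qed
    then have "weighted_degree ?w f = 0" "weighted_degree ?w s = 0"
      using weighted_degree_tmul[of ?w f s] assms by (simp_all add: lookup_add)
    then show ?thesis using that(2) le_weighted_degree[of a f ?w] le_weighted_degree[of a s ?w] by auto
  qed
  then show "f \<in> polys V" "s \<in> polys V"
    by (auto simp: polys_def in_keys_iff)
qed

definition total_degree :: "((nat \<Rightarrow>\<^sub>0 nat) \<Rightarrow>\<^sub>0 'k) \<Rightarrow> nat"
  where "total_degree = weighted_degree exponent_degree"

lemma total_degree_tmul: "f \<noteq> 0 \<Longrightarrow> g \<noteq> 0 \<Longrightarrow> total_degree (f \<star> g) = total_degree f + total_degree g"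
  unfolding total_degree_def by (rule weighted_degree_tmul) (rule exponent_degree_add)

definition scalar :: "((nat \<Rightarrow>\<^sub>0 nat) \<Rightarrow>\<^sub>0 'k) \<Rightarrow> bool"
  where "scalar f \<longleftrightarrow> f \<in> polys {}"

lemma scalar_iff: "scalar f \<longleftrightarrow> (\<exists>c. f = single 0 c)"
proof
  assume "scalar f"
  then have "f = single 0 (lookup f 0)"
    by (intro poly_mapping_eqI) (auto simp: scalar_def polys_def lookup_single when_def in_keys_iff)
  then show "\<exists>c. f = single 0 c" ..
qed (auto simp: scalar_def)

lemma scalar_iff_total_degree: "scalar f \<longleftrightarrow> total_degree f = 0"
  unfolding total_degree_def using weighted_degree_le_iff[of exponent_degree f 0] by (auto simp: scalar_def polys_def)

lemma scalar_divides:
  assumes "scalar s" "s \<noteq> 0"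
  shows "s divides f" "f \<star> s divides g \<longleftrightarrow> f divides g"
proof -
  obtain c where c: "s = single 0 c" "c \<noteq> 0" using assms unfolding scalar_iff by (metis single_zero)
  have inv: "s \<star> single 0 (1 / c) = 1" using c by (simp add: tmul_single_single)
  then show "s divides f" unfolding divides_def by (metis one_tmul tmul_assoc)
  show "f \<star> s divides g \<longleftrightarrow> f divides g"
    unfolding divides_def using inv by (metis one_tmul tmul_assoc)
qed

section \<open>Irreducible homogeneous elements are prime\<close>

text \<open>
  Irreducibility, and primeness below, are tested on homogeneous elements only. Among these the
  algebra is commutative up to scalars, so that the factorization theory of commutative
  polynomials applies.
\<close>
definition irreducible :: "((nat \<Rightarrow>\<^sub>0 nat) \<Rightarrow>\<^sub>0 'k) \<Rightarrow> bool"
  where "irreducible f \<longleftrightarrow> homogeneous f \<and> \<not> scalar f \<and>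
    (\<forall>g h. homogeneous g \<longrightarrow> homogeneous h \<longrightarrow> f = g \<star> h \<longrightarrow> scalar g \<or> scalar h)"

definition prime_in :: "nat set \<Rightarrow> ((nat \<Rightarrow>\<^sub>0 nat) \<Rightarrow>\<^sub>0 'k) \<Rightarrow> bool"
  where "prime_in V f \<longleftrightarrow> (\<forall>g\<in>polys V. \<forall>h\<in>polys V. homogeneous g \<longrightarrow> homogeneous h \<longrightarrow>
    f divides g \<star> h \<longrightarrow> f divides g \<or> f divides h)"

lemma irreducible_nonzero: "irreducible f \<Longrightarrow> f \<noteq> 0"
  by (auto simp: irreducible_def scalar_def)

lemma irreducible_factor:
  assumes "homogeneous r" "\<not> scalar r"
  shows "\<exists>p s. irreducible p \<and> homogeneous s \<and> r = p \<star> s"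
  using assms
proof (induction "total_degree r" arbitrary: r rule: less_induct)
  case less
  have r: "r \<noteq> 0" using less.prems by (auto simp: scalar_def)
  show ?case
  proof (cases "irreducible r")
    case True
    moreover have "r = r \<star> 1" by simp
    ultimately show ?thesis using homogeneous_one by blast
  next
    case False
    then obtain g h where gh: "homogeneous g" "homogeneous h" "r = g \<star> h" "\<not> scalar g" "\<not> scalar h"
      using less.prems by (auto simp: irreducible_def)
    then have "total_degree g < total_degree r"
      using r total_degree_tmul[of g h] by (auto simp: scalar_iff_total_degree)
    then obtain p s where "irreducible p" "homogeneous s" "g = p \<star> s"
      using less.hyps gh by blast
    moreover from this have "homogeneous (s \<star> h)" "r = p \<star> (s \<star> h)"
      using gh by (simp_all add: homogeneous_tmul tmul_assoc)
    ultimately show ?thesis by blast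
  qed
qed

text \<open>
  This is the analogue of a primitive polynomial when the variables in \<open>V\<close> generate
  the coefficient ring.
\<close>
definition primitive_over :: "nat set \<Rightarrow> ((nat \<Rightarrow>\<^sub>0 nat) \<Rightarrow>\<^sub>0 'k) \<Rightarrow> bool"
  where "primitive_over V f \<longleftrightarrow> (\<forall>r\<in>polys V. homogeneous r \<longrightarrow> r divides f \<longrightarrow> scalar r)"

text \<open>
  Split off nonscalar factors from the coefficient ring as long as there are any; the total degree
  decreases.
\<close>
lemma primitive_part:
  assumes "homogeneous d" "d \<noteq> 0"
  shows "\<exists>c d'. c \<in> polys V \<and> homogeneous c \<and> homogeneous d' \<and> primitive_over V d' \<and> d = c \<star> d'"
  using assms
proof (induction "total_degree d" arbitrary: d rule: less_induct)
  case less
  show ?case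
  proof (cases "primitive_over V d")
    case True
    moreover have "d = 1 \<star> d" by simp
    ultimately show ?thesis using less.prems polys_one homogeneous_one by blast
  next
    case False
    then obtain r s where r: "r \<in> polys V" "homogeneous r" "\<not> scalar r" "d = r \<star> s"
      by (auto simp: primitive_over_def divides_def)
    then have nz: "r \<noteq> 0" "s \<noteq> 0" using less.prems by auto
    have s: "homogeneous s" using homogeneous_cofactor[of r s] r less.prems nz by simp
    have "total_degree s < total_degree d" using total_degree_tmul[OF nz] r by (simp add: scalar_iff_total_degree)
    then obtain c d' where cd: "c \<in> polys V" "homogeneous c" "homogeneous d'" "primitive_over V d'" "s = c \<star> d'"
      using less.hyps s nz by blast
    then have "r \<star> c \<in> polys V" "homogeneous (r \<star> c)" "d = (r \<star> c) \<star> d'"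
      using r by (simp_all add: homogeneous_tmul tmul_assoc polys_tmul)
    with cd show ?thesis by blast
  qed
qed

abbreviation var_power :: "nat \<Rightarrow> nat \<Rightarrow> (nat \<Rightarrow>\<^sub>0 nat) \<Rightarrow>\<^sub>0 'k"
  where "var_power v k \<equiv> single (single v k) 1"

lemma var_power_add: "\<exists>c. c \<noteq> 0 \<and> var_power v i \<star> var_power v j = single 0 c \<star> var_power v (i + j)"
  by (intro exI[of _ "q (single v i) (single v j)"]) (simp add: tmul_single_single single_add)

lemma coefficient_of_var_power:
  assumes g: "g \<in> polys (insert v V)" and v: "v \<notin> V" and k: "\<And>a. a \<in> keys g \<Longrightarrow> lookup a v = k"
  shows "\<exists>l\<in>polys V. g = l \<star> var_power v k \<and> (homogeneous g \<longrightarrow> homogeneous l)"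
proof -
  have "\<exists>c. a = c + single v k" if "a \<in> keys g" for a
    using k[OF that]
    by (intro exI[of _ "a - single v k"] poly_mapping_eqI)
      (auto simp: lookup_add lookup_minus lookup_single when_def)
  then obtain l where l: "g = l \<star> var_power v k" using right_factor_monomial by blast
  then have key: "c + single v k \<in> keys g" if "c \<in> keys l" for c
    using that by (auto simp: keys_tmul_single)
  have "keys c \<subseteq> V" if "c \<in> keys l" for c
  proof -
    have "lookup c v = 0" using k[OF key[OF that]] by (simp add: lookup_add)
    moreover have "keys c \<subseteq> insert v V" using key[OF that] g unfolding polys_def keys_add_nat[symmetric]
      by (auto simp: keys_add_nat dest!: bspec)
    ultimately show ?thesis by (auto simp: in_keys_iff)
  qed
  then have "l \<in> polys V" by (simp add: polys_def)
  moreover have "homogeneous l" if "homogeneous g"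
    unfolding homogeneous_def
  proof (intro ballI)
    fix a b assume "a \<in> keys l" "b \<in> keys l"
    then have "same_character (a + single v k) (b + single v k)"
      using key that unfolding homogeneous_def by blast
    then show "same_character a b" by simp
  qed
  ultimately show ?thesis using l by blast
qed

abbreviation vdeg :: "nat \<Rightarrow> ((nat \<Rightarrow>\<^sub>0 nat) \<Rightarrow>\<^sub>0 'k) \<Rightarrow> nat"
  where "vdeg v \<equiv> weighted_degree (\<lambda>a. lookup a v)"

abbreviation vtop :: "nat \<Rightarrow> ((nat \<Rightarrow>\<^sub>0 nat) \<Rightarrow>\<^sub>0 'k) \<Rightarrow> ((nat \<Rightarrow>\<^sub>0 nat) \<Rightarrow>\<^sub>0 'k)"
  where "vtop v \<equiv> top_part (\<lambda>a. lookup a v)"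

lemma leading_coefficient:
  assumes "g \<in> polys (insert v V)" "v \<notin> V" "homogeneous g"
  obtains l where "l \<in> polys V" "homogeneous l" "vtop v g = l \<star> var_power v (vdeg v g)"
proof -
  have "\<exists>l\<in>polys V. vtop v g = l \<star> var_power v (vdeg v g) \<and> (homogeneous (vtop v g) \<longrightarrow> homogeneous l)"
    using assms
    by (intro coefficient_of_var_power) (auto simp: top_part_def polys_restr keys_restr)
  moreover have "homogeneous (vtop v g)"
    using assms by (simp add: top_part_def homogeneous_restr)
  ultimately show ?thesis using that by blast
qed

lemma restr_coefficient_tmul:
  assumes "p \<in> polys V" "v \<notin> V"
  shows "restr (\<lambda>a. lookup a v = k) (p \<star> s) = p \<star> restr (\<lambda>a. lookup a v = k) s"
proof -
  have "restr (\<lambda>a. lookup a v = k) (p \<star> s) = restr (\<lambda>a. True) p \<star> restr (\<lambda>a. lookup a v = k) s"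
    using polys_lookup[OF assms(1) _ assms(2)] by (intro restr_tmul) (auto simp: lookup_add)
  then show ?thesis by (simp add: restr_id)
qed

text \<open>
  The variable \<open>x\<^sub>v\<close> can be moved to the right past the homogeneous coefficient
  \<open>l'\<close> at the cost of a scalar.
\<close>
lemma product_of_top_parts:
  assumes "homogeneous l" "homogeneous l'"
  shows "\<exists>c. c \<noteq> 0 \<and> (l \<star> var_power v i) \<star> (l' \<star> var_power v j) =
    single 0 c \<star> (l \<star> l' \<star> var_power v (i + j))"
proof -
  obtain c where c: "c \<noteq> 0" "var_power v i \<star> l' = single 0 c \<star> (l' \<star> var_power v i)"
    using homogeneous_skew_commute[of "var_power v i" l'] assms by auto
  obtain e where e: "e \<noteq> 0" "var_power v i \<star> var_power v j = single 0 e \<star> var_power v (i + j)"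
    using var_power_add by blast
  have "(l \<star> var_power v i) \<star> (l' \<star> var_power v j) = l \<star> (var_power v i \<star> l') \<star> var_power v j"
    by (simp add: tmul_assoc)
  also have "\<dots> = l \<star> single 0 c \<star> l' \<star> (var_power v i \<star> var_power v j)"
    by (simp add: tmul_assoc c)
  also have "\<dots> = single 0 c \<star> l \<star> (l' \<star> single 0 e) \<star> var_power v (i + j)"
    by (simp only: e(2) tmul_assoc[symmetric] scalar_commute[of l])
  also have "\<dots> = single 0 c \<star> (l \<star> single 0 e) \<star> l' \<star> var_power v (i + j)"
    by (simp only: tmul_assoc scalar_commute[of l'])
  also have "\<dots> = single 0 (c * e) \<star> (l \<star> l' \<star> var_power v (i + j))"
    by (simp only: scalar_commute[of l]) (simp add: tmul_assoc scalar_scalar)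
  finally show ?thesis using c e by (intro exI[of _ "c * e"]) simp
qed

text \<open>
  If \<open>p\<close> divides \<open>g h\<close>, then it divides the product of the leading
  coefficients in the new variable, hence one of them. The corresponding leading term can be
  subtracted, and the argument repeated with fewer terms.
\<close>
lemma prime_in_insert:
  assumes p: "p \<in> polys V" "homogeneous p" "p \<noteq> 0" "prime_in V p" and v: "v \<notin> V"
  shows "prime_in (insert v V) p"
  unfolding prime_in_def
proof (intro ballI impI)
  let ?W = "insert v V"
  fix g h assume "g \<in> polys ?W" "h \<in> polys ?W" "homogeneous g" "homogeneous h" "p divides g \<star> h"
  then show "p divides g \<or> p divides h"
  proof (induction "card (keys g) + card (keys h)" arbitrary: g h rule: less_induct)
    case less
    show ?case
    proof (cases "g = 0 \<or> h = 0")
      case True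
      then show ?thesis by auto
    next
      case False
      let ?i = "vdeg v g" and ?j = "vdeg v h"
      have smaller: "card (keys (f - vtop v f)) < card (keys f)" and
          subset: "keys (f - vtop v f) \<subseteq> keys f" if "f \<noteq> 0" for f
      proof -
        have "keys (f - vtop v f) = keys f - keys (vtop v f)"
          by (auto simp: top_part_def in_keys_iff lookup_minus lookup_restr split: if_splits)
        moreover have "keys (vtop v f) \<noteq> {}" "keys (vtop v f) \<subseteq> keys f"
          using top_part_nonzero[OF that, of "\<lambda>a. lookup a v"] by (simp, auto simp: top_part_def keys_restr)
        ultimately have "keys (f - vtop v f) \<subset> keys f" by blast
        then show "card (keys (f - vtop v f)) < card (keys f)" "keys (f - vtop v f) \<subseteq> keys f"
          by (auto intro: psubset_card_mono)
      qed
      obtain l where l: "l \<in> polys V" "homogeneous l" "vtop v g = l \<star> var_power v ?i"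
        using leading_coefficient less.prems v by metis
      obtain l' where l': "l' \<in> polys V" "homogeneous l'" "vtop v h = l' \<star> var_power v ?j"
        using leading_coefficient less.prems v by metis
      obtain s where s: "g \<star> h = p \<star> s" using less.prems by (auto simp: divides_def)
      obtain c where c: "c \<noteq> 0" "vtop v g \<star> vtop v h = single 0 c \<star> (l \<star> l' \<star> var_power v (?i + ?j))"
        using product_of_top_parts l l' by metis
      define t where "t = restr (\<lambda>a. lookup a v = ?i + ?j) s"
      have pt: "p \<star> t = vtop v g \<star> vtop v h"
        unfolding t_def restr_coefficient_tmul[OF p(1) v, symmetric] s[symmetric]
        by (rule restr_top_tmul) (rule lookup_add)
      have "s \<in> polys ?W"
        using polys_factors(2)[of p s ?W] s p polys_tmul[of g ?W h] less.prems by (cases "s = 0") auto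
      then have "\<exists>t'\<in>polys V. t = t' \<star> var_power v (?i + ?j) \<and> (homogeneous t \<longrightarrow> homogeneous t')"
        using v by (intro coefficient_of_var_power) (auto simp: t_def keys_restr polys_restr)
      then obtain t' where t': "t = t' \<star> var_power v (?i + ?j)" by blast
      have "(p \<star> t') \<star> var_power v (?i + ?j) = (single 0 c \<star> (l \<star> l')) \<star> var_power v (?i + ?j)"
        using pt c(2) t' by (simp add: tmul_assoc)
      then have "p \<star> t' = single 0 c \<star> (l \<star> l')"
        by (subst (asm) tmul_right_cancel) auto
      then have "p divides l \<star> l'"
        using c(1) divides_scalar_iff by (metis divides_def)
      then have "p divides l \<or> p divides l'"
        using p(4) l l' by (simp add: prime_in_def)
      then show ?thesis
      proof
        assume "p divides l"
        then have top: "p divides vtop v g" using l(3) divides_tmul_right by simp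
        have "p divides (g - vtop v g) \<star> h"
          unfolding tmul_diff_left using top less.prems by (intro divides_diff) (simp_all add: divides_tmul_right)
        then have "p divides g - vtop v g \<or> p divides h"
          using smaller[of g] subset[of g] False less.prems
          by (intro less.hyps) (auto intro: polys_subset_keys homogeneous_subset)
        then show ?thesis using divides_add[OF _ top, of "g - vtop v g"] by auto
      next
        assume "p divides l'"
        then have top: "p divides vtop v h" using l'(3) divides_tmul_right by simp
        have "p divides g \<star> (h - vtop v h)"
          unfolding tmul_diff_right using top less.prems p(2) by (intro divides_diff) (simp_all add: divides_tmul_left)
        then have "p divides g \<or> p divides h - vtop v h"
          using smaller[of h] subset[of h] False less.prems
          by (intro less.hyps) (auto intro: polys_subset_keys homogeneous_subset)
        then show ?thesis using divides_add[OF _ top, of "h - vtop v h"] by auto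
      qed
    qed
  qed
qed

text \<open>
  Gauss's lemma. An irreducible factor \<open>p\<close> of \<open>r\<close> is prime also after
  adjoining the variable \<open>v\<close>. It divides \<open>r g = f s\<close> but not the
  primitive \<open>f\<close>, hence it divides \<open>s\<close> and can be cancelled.
\<close>
lemma primitive_cancel:
  assumes IH: "\<And>p. p \<in> polys V \<Longrightarrow> irreducible p \<Longrightarrow> prime_in V p" and v: "v \<notin> V"
    and f: "f \<in> polys (insert v V)" "homogeneous f" "f \<noteq> 0" "primitive_over V f"
    and g: "g \<in> polys (insert v V)" "homogeneous g"
    and r: "r \<in> polys V" "homogeneous r" "r \<noteq> 0" "f divides r \<star> g"
  shows "f divides g"
  using r
proof (induction "total_degree r" arbitrary: r rule: less_induct)
  case (less r)
  show ?case
  proof (cases "g = 0 \<or> scalar r")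
    case True
    then show ?thesis
    proof
      assume "scalar r"
      then obtain c where "r = single 0 c" by (auto simp: scalar_iff)
      then show ?thesis using less.prems divides_scalar_iff[of c f g] by (cases "c = 0") auto
    qed simp
  next
    case False
    then obtain p r' where p: "irreducible p" "homogeneous r'" "r = p \<star> r'"
      using irreducible_factor less.prems by blast
    then have nz: "p \<noteq> 0" "r' \<noteq> 0" "homogeneous p" using less.prems by (auto simp: irreducible_def)
    have polys: "p \<in> polys V" "r' \<in> polys V" using polys_factors[of p r' V] nz less.prems p by auto
    obtain s where s: "r \<star> g = f \<star> s" using less.prems by (auto simp: divides_def)
    have rg: "r \<star> g \<in> polys (insert v V)" "r \<star> g \<noteq> 0" "homogeneous (r \<star> g)"
      using less.prems g False polys_mono[of V "insert v V"]
      by (auto intro!: polys_tmul homogeneous_tmul)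
    have s': "s \<noteq> 0" "homogeneous s" "s \<in> polys (insert v V)"
      using rg s f polys_factors[of f s "insert v V"] homogeneous_cofactor[of f s] by auto
    have "prime_in (insert v V) p"
      using prime_in_insert IH polys nz p v by blast
    moreover have "p divides f \<star> s"
      using s p by (metis divides_def tmul_assoc)
    ultimately have "p divides f \<or> p divides s"
      using f s' by (simp add: prime_in_def)
    moreover have "\<not> p divides f"
      using f(4) polys nz p(1) by (auto simp: primitive_over_def irreducible_def)
    ultimately obtain u where u: "s = p \<star> u" by (auto simp: divides_def)
    obtain c where c: "f \<star> p = single 0 c \<star> (p \<star> f)"
      using homogeneous_skew_commute f nz by blast
    have "p \<star> (r' \<star> g) = (f \<star> p) \<star> u"
      using s u p by (simp add: tmul_assoc)
    also have "\<dots> = (p \<star> single 0 c) \<star> f \<star> u"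
      by (simp only: c scalar_commute) (simp only: tmul_assoc)
    also have "\<dots> = p \<star> (f \<star> single 0 c \<star> u)"
      by (simp only: scalar_commute[of f]) (simp only: tmul_assoc)
    finally have "f divides r' \<star> g"
      using tmul_left_cancel[of p] nz by (metis divides_def tmul_assoc)
    moreover have "total_degree r' < total_degree r"
      using total_degree_tmul[of p r'] nz p by (simp add: irreducible_def scalar_iff_total_degree)
    ultimately show ?thesis
      using less.hyps polys p nz by blast
  qed
qed

text \<open>
  Before each step of the division, \<open>f\<close> is multiplied by the leading coefficient of
  \<open>d\<close>, since that coefficient need not be invertible. The remainders stay
  homogeneous, because the two products whose difference is taken have an exponent in common.
\<close>
lemma pseudo_division:
  assumes v: "v \<notin> V" and d: "d \<in> polys (insert v V)" "homogeneous d" "d \<noteq> 0"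
    and f: "f \<in> polys (insert v V)" "homogeneous f"
  shows "\<exists>r h e. r \<in> polys V \<and> homogeneous r \<and> r \<noteq> 0 \<and> h \<in> polys (insert v V) \<and>
    e \<in> polys (insert v V) \<and> homogeneous e \<and> r \<star> f = h \<star> d + e \<and> (e = 0 \<or> vdeg v e < vdeg v d)"
  using f
proof (induction "vdeg v f" arbitrary: f rule: less_induct)
  case (less f)
  let ?W = "insert v V" and ?m = "vdeg v f" and ?e = "vdeg v d"
  have VW: "x \<in> polys ?W" if "x \<in> polys V" for x using that polys_mono[of V ?W] by blast
  show ?case
  proof (cases "f = 0 \<or> ?m < ?e")
    case True
    moreover have "1 \<star> f = 0 \<star> d + f" by simp
    moreover have "(1 :: (nat \<Rightarrow>\<^sub>0 nat) \<Rightarrow>\<^sub>0 'k) \<noteq> 0" by simp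
    ultimately show ?thesis using less.prems polys_one polys_zero homogeneous_one by blast
  next
    case False
    obtain lf where lf: "lf \<in> polys V" "homogeneous lf" "vtop v f = lf \<star> var_power v ?m"
      using leading_coefficient less.prems v by metis
    obtain ld where ld: "ld \<in> polys V" "homogeneous ld" "vtop v d = ld \<star> var_power v ?e"
      using leading_coefficient d v by metis
    have ld0: "ld \<noteq> 0" using top_part_nonzero[OF d(3)] ld(3) by (metis tmul_zero_left)
    have lf0: "lf \<noteq> 0" using top_part_nonzero[of f] False lf(3) by (metis tmul_zero_left)
    have me: "?m - ?e + ?e = ?m" using False by simp
    obtain c where c: "c \<noteq> 0" "(lf \<star> var_power v (?m - ?e)) \<star> vtop v d =
        single 0 c \<star> (lf \<star> ld \<star> var_power v ?m)"
      using product_of_top_parts[OF lf(2) ld(2), of v "?m - ?e" ?e] unfolding ld(3) me by blast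
    obtain c' where c': "c' \<noteq> 0" "ld \<star> lf = single 0 c' \<star> (lf \<star> ld)"
      using homogeneous_skew_commute ld lf by blast
    \<comment> \<open>The scalar makes the leading terms of \<open>h d\<close> and \<open>ld f\<close> agree.\<close>
    define h where "h = single 0 (c' / c) \<star> (lf \<star> var_power v (?m - ?e))"
    have h: "h \<in> polys ?W" "homogeneous h"
      using lf VW[OF lf(1)] polys_single[of "single v (?m - ?e)" ?W 1]
      by (auto simp: h_def intro!: polys_tmul homogeneous_tmul split: if_splits)
    define f' where "f' = ld \<star> f - h \<star> d"
    let ?P = "\<lambda>a. lookup a v = ?m"
    have top1: "restr ?P (ld \<star> f) = ld \<star> vtop v f"
      by (simp add: restr_coefficient_tmul[OF ld(1) v] top_part_def)
    have keysh: "lookup a v = ?m - ?e" if "a \<in> keys h" for a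
    proof -
      have "a \<in> keys (lf \<star> var_power v (?m - ?e))"
        using that c c' by (simp add: h_def keys_scalar)
      then show ?thesis using polys_lookup[OF lf(1) _ v] by (auto simp: keys_tmul_single lookup_add)
    qed
    have "restr ?P (h \<star> d) = restr (\<lambda>_. True) h \<star> restr (\<lambda>a. lookup a v = ?e) d"
      using False keysh by (intro restr_tmul) (auto simp: lookup_add)
    then have "restr ?P (h \<star> d) = h \<star> vtop v d"
      by (simp add: restr_id top_part_def)
    also have "\<dots> = single 0 (c' / c) \<star> (single 0 c \<star> (lf \<star> ld \<star> var_power v ?m))"
      unfolding h_def tmul_assoc[of "single 0 (c' / c)"] c(2) ..
    also have "\<dots> = single 0 c' \<star> (lf \<star> ld) \<star> var_power v ?m"
      using c by (simp add: scalar_scalar tmul_assoc)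
    also have "\<dots> = restr ?P (ld \<star> f)"
      unfolding top1 lf(3) by (simp only: tmul_assoc[symmetric] c'(2))
    finally have tops: "restr ?P (h \<star> d) = restr ?P (ld \<star> f)" .
    have top_nz: "restr ?P (ld \<star> f) \<noteq> 0"
      unfolding top1 using ld0 top_part_nonzero[of f] False by simp
    have key_le: "lookup a v \<le> ?m" if "a \<in> keys f'" for a
    proof -
      have "a \<in> keys (ld \<star> f) \<or> a \<in> keys (h \<star> d)"
        using that by (auto simp: f'_def in_keys_iff lookup_minus)
      moreover have "vdeg v (ld \<star> f) = ?m"
        using weighted_degree_tmul[of "\<lambda>a. lookup a v" ld f] ld0 False ld(1) v weighted_degree_le_iff[of "\<lambda>a. lookup a v" ld 0]
          polys_lookup[OF ld(1) _ v]
        by (auto simp: lookup_add)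
      moreover have "lookup a v \<le> ?m" if "a \<in> keys (h \<star> d)"
      proof -
        obtain b b' where "b \<in> keys h" "b' \<in> keys d" "a = b + b'"
          using keys_tmul \<open>a \<in> keys (h \<star> d)\<close> by blast
        then show ?thesis using keysh[of b] le_weighted_degree[of b' d "\<lambda>a. lookup a v"] False
          by (simp add: lookup_add)
      qed
      ultimately show ?thesis using le_weighted_degree[of a "ld \<star> f" "\<lambda>a. lookup a v"] by auto
    qed
    have key_neq: "lookup a v \<noteq> ?m" if "a \<in> keys f'" for a
    proof
      assume "lookup a v = ?m"
      then have "lookup (restr ?P (ld \<star> f)) a - lookup (restr ?P (h \<star> d)) a = lookup f' a"
        by (simp add: f'_def lookup_restr lookup_minus)
      then show False using tops that by (simp add: in_keys_iff)
    qed
    obtain a where "a \<in> keys (restr ?P (ld \<star> f))" "a \<in> keys (restr ?P (h \<star> d))"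
      using ex_key[OF top_nz] tops by auto
    then have f': "f' \<in> polys ?W" "homogeneous f'"
      using h ld less.prems d
      by (auto simp: f'_def keys_restr intro!: polys_diff polys_tmul homogeneous_diff[of _ _ a] homogeneous_tmul VW[OF ld(1)])
    show ?thesis
    proof (cases "f' = 0")
      case True
      then have "ld \<star> f = h \<star> d + 0" by (simp add: f'_def)
      moreover have "homogeneous 0" by (simp add: homogeneous_def)
      ultimately show ?thesis using h ld ld0 polys_zero by blast
    next
      case False
      then obtain a where "a \<in> keys f'" "lookup a v = vdeg v f'"
        using weighted_degree_attained[of f' "\<lambda>a. lookup a v"] by blast
      then have "vdeg v f' < ?m" using key_le[of a] key_neq[of a] by simp
      then obtain r h' e where r: "r \<in> polys V" "homogeneous r" "r \<noteq> 0" "h' \<in> polys ?W" "e \<in> polys ?W"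
          "homogeneous e" "r \<star> f' = h' \<star> d + e" "e = 0 \<or> vdeg v e < ?e"
        using less.hyps f' by blast
      have "r \<star> ld \<star> f = r \<star> f' + r \<star> h \<star> d"
        by (simp add: f'_def tmul_diff_right tmul_assoc)
      also have "\<dots> = (h' + r \<star> h) \<star> d + e"
        by (simp add: r tmul_distrib_right)
      finally have "r \<star> ld \<star> f = (h' + r \<star> h) \<star> d + e" .
      moreover have "r \<star> ld \<in> polys V" "homogeneous (r \<star> ld)" "r \<star> ld \<noteq> 0" "h' + r \<star> h \<in> polys ?W"
        using r ld ld0 h VW[OF r(1)] by (simp_all add: polys_tmul homogeneous_tmul polys_add)
      ultimately show ?thesis using r(5,6,8) by blast
    qed
  qed
qed

text \<open>
  The Bezout argument over the fraction field of the coefficients, with denominators cleared: an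
  element \<open>d\<close> of least degree in \<open>v\<close> in the left ideal generated by
  \<open>f\<close> and \<open>g\<close> divides both of them up to coefficients. So its primitive
  part divides \<open>f\<close> and \<open>g\<close>. If \<open>f\<close> does not divide
  \<open>g\<close>, this primitive part is a scalar and \<open>d = u f + w g\<close> does not
  involve \<open>v\<close>; then \<open>f\<close> divides \<open>d h\<close>, and \<open>d\<close>
  can be cancelled by Gauss's lemma.
\<close>
lemma prime_in_insert_primitive:
  assumes IH: "\<And>p. p \<in> polys V \<Longrightarrow> irreducible p \<Longrightarrow> prime_in V p" and v: "v \<notin> V"
    and f: "f \<in> polys (insert v V)" "irreducible f" "f \<notin> polys V"
  shows "prime_in (insert v V) f"
  unfolding prime_in_def
proof (intro ballI impI)
  let ?W = "insert v V"
  fix g h assume g: "g \<in> polys ?W" "homogeneous g" and h: "h \<in> polys ?W" "homogeneous h"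
    and gh: "f divides g \<star> h"
  have VW: "x \<in> polys ?W" if "x \<in> polys V" for x using that polys_mono[of V ?W] by blast
  have f': "homogeneous f" "f \<noteq> 0" using f irreducible_nonzero by (auto simp: irreducible_def)
  have prim: "primitive_over V f"
    unfolding primitive_over_def
  proof (intro ballI impI)
    fix r assume r: "r \<in> polys V" "homogeneous r" "r divides f"
    then obtain s where s: "f = r \<star> s" by (auto simp: divides_def)
    then have "homogeneous s" using homogeneous_cofactor[of r s] r f' by auto
    then have "scalar r \<or> scalar s" using r s f(2) by (auto simp: irreducible_def)
    moreover have "\<not> scalar s"
      using s r f(3) polys_mono[of "{}" V] by (auto simp: scalar_def dest: polys_tmul)
    ultimately show "scalar r" by blast
  qed
  show "f divides g \<or> f divides h"
  proof (rule ccontr)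
    assume neg: "\<not> (f divides g \<or> f divides h)"
    \<comment> \<open>The combination has to be homogeneous, but its coefficients \<open>u\<close> and \<open>w\<close> need not be.\<close>
    define J where "J = {x \<in> polys ?W. homogeneous x \<and> x \<noteq> 0 \<and>
      (\<exists>u\<in>polys ?W. \<exists>w\<in>polys ?W. x = u \<star> f + w \<star> g)}"
    have "f = 1 \<star> f + 0 \<star> g" by simp
    then have "f \<in> J"
      unfolding J_def using f(1) f' polys_one polys_zero by blast
    then obtain d where d: "d \<in> J" and min: "\<And>x. x \<in> J \<Longrightarrow> vdeg v d \<le> vdeg v x"
      using ex_has_least_nat[of "\<lambda>x. x \<in> J" f "vdeg v"] by blast
    then obtain u w where uw: "u \<in> polys ?W" "w \<in> polys ?W" "d = u \<star> f + w \<star> g"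
      by (auto simp: J_def)
    have d': "d \<in> polys ?W" "homogeneous d" "d \<noteq> 0" using d by (auto simp: J_def)
    have exact: "\<exists>r k. r \<in> polys V \<and> homogeneous r \<and> r \<noteq> 0 \<and> r \<star> x = k \<star> d"
      if x: "x \<in> polys ?W" "homogeneous x"
        and xs: "u' \<in> polys ?W" "w' \<in> polys ?W" "x = u' \<star> f + w' \<star> g" for x u' w'
    proof -
      obtain r k e where r: "r \<in> polys V" "homogeneous r" "r \<noteq> 0" "k \<in> polys ?W" "e \<in> polys ?W"
          "homogeneous e" "r \<star> x = k \<star> d + e" "e = 0 \<or> vdeg v e < vdeg v d"
        using pseudo_division[OF v d' x] by blast
      have "e = r \<star> x - k \<star> d" using r(7) by simp
      also have "\<dots> = (r \<star> u' - k \<star> u) \<star> f + (r \<star> w' - k \<star> w) \<star> g"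
        by (simp add: uw(3) xs(3) tmul_distrib_left tmul_diff_left tmul_assoc)
      finally have "e = (r \<star> u' - k \<star> u) \<star> f + (r \<star> w' - k \<star> w) \<star> g" .
      moreover have "r \<star> u' - k \<star> u \<in> polys ?W" "r \<star> w' - k \<star> w \<in> polys ?W"
        using VW[OF r(1)] r(4) uw(1,2) xs(1,2) by (simp_all add: polys_diff polys_tmul)
      ultimately have "e = 0 \<or> e \<in> J" using r by (auto simp: J_def)
      then have "e = 0" using min[of e] r(8) by auto
      then show ?thesis using r by auto
    qed
    obtain c d1 where cd: "c \<in> polys V" "homogeneous c" "homogeneous d1" "primitive_over V d1" "d = c \<star> d1"
      using primitive_part d' by blast
    then have d1: "d1 \<noteq> 0" "d1 \<in> polys ?W" using d' polys_factors[of c d1 ?W] by auto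
    have d1_divides: "d1 divides x" if xs: "x \<in> polys ?W" "homogeneous x"
      "u' \<in> polys ?W" "w' \<in> polys ?W" "x = u' \<star> f + w' \<star> g" for x u' w'
    proof -
      obtain r k where r: "r \<in> polys V" "homogeneous r" "r \<noteq> 0" "r \<star> x = k \<star> d"
        using exact[OF xs] by blast
      have "d1 divides r \<star> x"
        unfolding r(4) cd(5) using cd by (intro divides_tmul_left) auto
      then show ?thesis
        using primitive_cancel[OF IH v d1(2) cd(3) d1(1) cd(4) xs(1,2)] r by blast
    qed
    have "d1 divides f"
      using f f' by (intro d1_divides[of f 1 0]) auto
    then obtain s where s: "f = d1 \<star> s" by (auto simp: divides_def)
    then have "homogeneous s" using homogeneous_cofactor[of d1 s] f' cd d1 by auto
    then have "scalar d1 \<or> scalar s" using f(2) s cd by (auto simp: irreducible_def)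
    then show False
    proof
      assume "scalar s"
      moreover have "s \<noteq> 0" using s f' by auto
      moreover have "d1 divides g"
        using g by (intro d1_divides[of g 0 1]) auto
      ultimately have "f divides g" using s scalar_divides(2) by simp
      then show False using neg by blast
    next
      assume "scalar d1"
      then have "d \<in> polys V"
        using cd polys_mono[of "{}" V] by (auto simp: scalar_def intro!: polys_tmul)
      moreover have "f divides d \<star> h"
        unfolding uw(3) tmul_distrib_right tmul_assoc
        using f' gh by (intro divides_add) (simp_all add: divides_tmul_left divides_tmul_right)
      ultimately have "f divides h"
        using primitive_cancel[OF IH v f(1) f' prim h] d' by blast
      then show False using neg by blast
    qed
  qed
qed

text \<open>
  Induction on the variables. An irreducible element in which the new variable does not occur is
  prime by induction and stays prime; all others are primitive over the old variables.
\<close>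
theorem irreducible_imp_prime:
  assumes "finite V" "f \<in> polys V" "irreducible f"
  shows "prime_in V f"
  using assms
proof (induction V arbitrary: f rule: finite_induct)
  case empty
  then show ?case by (simp add: irreducible_def scalar_def)
next
  case (insert v V)
  show ?case
  proof (cases "f \<in> polys V")
    case True
    then show ?thesis
      using insert prime_in_insert irreducible_nonzero by (simp add: irreducible_def)
  next
    case False
    then show ?thesis using insert by (intro prime_in_insert_primitive)
  qed
qed

end

section \<open>Dickson's lemma and generation by leading monomials\<close>

lemma incseq_subsequence:
  fixes f :: "nat \<Rightarrow> nat"
  shows "\<exists>r. strict_mono r \<and> incseq (f \<circ> r)"
proof -
  obtain r :: "nat \<Rightarrow> nat" where r: "strict_mono r" "monoseq (\<lambda>n. f (r n))"
    using seq_monosub by blast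
  show ?thesis
  proof (cases "incseq (\<lambda>n. f (r n))")
    case True
    then show ?thesis using r by (auto simp: comp_def)
  next
    case False
    then have dec: "decseq (\<lambda>n. f (r n))" using r(2) by (simp add: monoseq_iff)
    obtain k where k: "\<And>n. f (r k) \<le> f (r n)"
      using ex_has_least_nat[of "\<lambda>_. True" _ "\<lambda>n. f (r n)"] by auto
    have "f (r (n + k)) = f (r k)" for n
      using k[of "n + k"] decseqD[OF dec, of k "n + k"] by simp
    moreover have "strict_mono (\<lambda>n. r (n + k))"
      using r(1) by (simp add: strict_mono_def)
    ultimately show ?thesis
      by (intro exI[of _ "\<lambda>n. r (n + k)"]) (simp add: comp_def incseq_def)
  qed
qed

lemma dickson_subsequence:
  fixes a :: "nat \<Rightarrow> ('i \<Rightarrow>\<^sub>0 nat)"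
  assumes "finite V"
  shows "\<exists>r. strict_mono r \<and> (\<forall>v\<in>V. incseq (\<lambda>k. lookup (a (r k)) v))"
  using assms
proof (induction V rule: finite_induct)
  case empty
  then show ?case using strict_mono_id by auto
next
  case (insert v V)
  then obtain r where r: "strict_mono r" "\<forall>v\<in>V. incseq (\<lambda>k. lookup (a (r k)) v)" by blast
  obtain s where s: "strict_mono s" "incseq ((\<lambda>k. lookup (a (r k)) v) \<circ> s)"
    using incseq_subsequence by blast
  have "incseq (\<lambda>k. lookup (a (r (s k))) u)" if "u \<in> insert v V" for u
    using that r(2) s by (auto simp: incseq_def comp_def strict_mono_less_eq)
  then show ?case
    using strict_mono_o[OF r(1) s(1)] by (intro exI[of _ "r \<circ> s"]) (auto simp: comp_def)
qed

lemma exponent_difference: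
  assumes "keys a \<subseteq> V" "\<And>v. v \<in> V \<Longrightarrow> lookup a v \<le> lookup b v"
  shows "b = a + (b - a :: 'i \<Rightarrow>\<^sub>0 nat)"
proof (rule poly_mapping_eqI)
  fix v show "lookup b v = lookup (a + (b - a)) v"
    using assms in_keys_iff[of v a] by (cases "v \<in> V") (auto simp: lookup_add lookup_minus)
qed

text \<open>
  Dickson's lemma: pass to a subsequence along which every coordinate is weakly increasing.
\<close>
lemma dickson_pair:
  fixes a :: "nat \<Rightarrow> ('i \<Rightarrow>\<^sub>0 nat)"
  assumes "finite V" "\<And>k. keys (a k) \<subseteq> V"
  shows "\<exists>i j c. i < j \<and> a j = a i + c"
proof -
  obtain r where r: "strict_mono r" "\<forall>v\<in>V. incseq (\<lambda>k. lookup (a (r k)) v)"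
    using dickson_subsequence[OF assms(1)] by blast
  have "a (r 1) = a (r 0) + (a (r 1) - a (r 0))"
    using r(2) assms(2) by (intro exponent_difference[of _ V]) (auto simp: incseq_def)
  moreover have "r 0 < r 1" using r(1) by (simp add: strict_mono_less)
  ultimately show ?thesis by blast
qed

lemma exponent_nonneg: "0 \<le> (c :: nat \<Rightarrow>\<^sub>0 nat)"
proof -
  have "\<not> c < 0"
    by transfer (simp add: less_fun_def)
  then show ?thesis by simp
qed

text \<open>
  The order extends divisibility of monomials, so a descending chain would contradict Dickson's
  lemma.
\<close>
lemma wf_exponents:
  assumes "finite V"
  shows "wf {(a, b :: nat \<Rightarrow>\<^sub>0 nat). a < b \<and> keys a \<subseteq> V \<and> keys b \<subseteq> V}"
  unfolding wf_iff_no_infinite_down_chain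
proof
  assume "\<exists>f. \<forall>i. (f (Suc i), f i) \<in> {(a, b :: nat \<Rightarrow>\<^sub>0 nat). a < b \<and> keys a \<subseteq> V \<and> keys b \<subseteq> V}"
  then obtain f :: "nat \<Rightarrow> nat \<Rightarrow>\<^sub>0 nat" where f: "\<And>i. f (Suc i) < f i" "\<And>i. keys (f i) \<subseteq> V" by auto
  obtain i j c where ij: "i < j" "f j = f i + c" using dickson_pair[of V f] assms f(2) by blast
  have "f j < f i"
    using ij(1) by (induction j) (auto simp: less_Suc_eq intro: f(1) less_trans[OF f(1)])
  moreover have "f i \<le> f j" using add_left_mono[OF exponent_nonneg[of c], of "f i"] ij by simp
  ultimately show False by simp
qed

text \<open>
  The minimal elements for divisibility form an antichain, which is finite by Dickson's lemma.
\<close>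
lemma dickson_basis:
  fixes D :: "('i \<Rightarrow>\<^sub>0 nat) set"
  assumes "finite V" "\<And>d. d \<in> D \<Longrightarrow> keys d \<subseteq> V"
  shows "\<exists>B\<subseteq>D. finite B \<and> (\<forall>d\<in>D. \<exists>b\<in>B. \<exists>c. d = c + b)"
proof -
  define B where "B = {b \<in> D. \<forall>d\<in>D. \<forall>c. b = c + d \<longrightarrow> c = 0}"
  have "finite B"
  proof (rule ccontr)
    assume "infinite B"
    then obtain a :: "nat \<Rightarrow> ('i \<Rightarrow>\<^sub>0 nat)" where a: "inj a" "range a \<subseteq> B"
      using infinite_countable_subset by blast
    then have "a k \<in> B" for k by blast
    then have "keys (a k) \<subseteq> V" for k using assms(2) by (simp add: B_def)
    then obtain i j c where ij: "i < j" "a j = a i + c" using dickson_pair[of V a] assms(1) by blast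
    have "a j \<in> B" "a i \<in> D" using \<open>\<And>k. a k \<in> B\<close> by (auto simp: B_def)
    then have "c = 0" using ij by (simp add: B_def add.commute)
    then show False using ij a(1) by (simp add: inj_eq)
  qed
  moreover have "\<exists>b\<in>B. \<exists>c. d = c + b" if "d \<in> D" for d
    using that
  proof (induction "exponent_degree d" arbitrary: d rule: less_induct)
    case less
    show ?case
    proof (cases "d \<in> B")
      case True
      then show ?thesis by (intro bexI[of _ d] exI[of _ 0]) simp_all
    next
      case False
      then obtain d' c where d': "d' \<in> D" "d = c + d'" "c \<noteq> 0" using less.prems by (auto simp: B_def)
      then have "exponent_degree c \<noteq> 0" by simp
      then have "exponent_degree d' < exponent_degree d" unfolding d'(2) exponent_degree_add by linarith
      then obtain b c' where "b \<in> B" "d' = c' + b" using less.hyps d' by blast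
      then show ?thesis using d' by (metis add.assoc)
    qed
  qed
  ultimately show ?thesis by (intro exI[of _ B]) (auto simp: B_def)
qed

context quantum_space
begin

text \<open>
  Left and right multiplication by monomials have the same effect on leading exponents, so one
  argument serves both sides: \<open>act\<close> stands for either of them. Finitely many elements
  of \<open>I\<close> have leading exponents that divide all the others; subtracting multiples of
  these elements lowers the leading exponent of any element of \<open>I\<close> until nothing is
  left.
\<close>
lemma leading_monomial_generation:
  assumes V: "finite V"
    and I: "I \<subseteq> polys V" "\<And>f g. f \<in> I \<Longrightarrow> g \<in> I \<Longrightarrow> f - g \<in> I"
    and act_in: "\<And>c f x. f \<in> I \<Longrightarrow> keys c \<subseteq> V \<Longrightarrow> single 0 x \<star> act c f \<in> I"
    and act_lm: "\<And>c f. f \<noteq> 0 \<Longrightarrow> act c f \<noteq> 0 \<and> lm (act c f) = c + lm f"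
  shows "\<exists>B\<subseteq>I. finite B \<and> (\<forall>K. 0 \<in> K \<longrightarrow> (\<forall>f\<in>K. \<forall>g\<in>K. f + g \<in> K) \<longrightarrow>
    (\<forall>f\<in>K. \<forall>c x. keys c \<subseteq> V \<longrightarrow> single 0 x \<star> act c f \<in> K) \<longrightarrow> B \<subseteq> K \<longrightarrow> I \<subseteq> K)"
proof -
  have lmV: "keys (lm f) \<subseteq> V" if "f \<in> I" "f \<noteq> 0" for f
    using lm_in_keys that I(1) by (auto simp: polys_def)
  have "\<exists>D\<subseteq>lm ` (I - {0}). finite D \<and> (\<forall>d\<in>lm ` (I - {0}). \<exists>b\<in>D. \<exists>c. d = c + b)"
    using V by (rule dickson_basis) (use lmV in auto)
  then obtain D where D: "D \<subseteq> lm ` (I - {0})" "finite D" "\<forall>d\<in>lm ` (I - {0}). \<exists>b\<in>D. \<exists>c. d = c + b"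
    by metis
  obtain B where B: "B \<subseteq> I - {0}" "finite B" "D = lm ` B"
    using finite_subset_image[OF D(2,1)] by blast
  have gen: "f \<in> K" if K: "0 \<in> K" "\<And>f g. f \<in> K \<Longrightarrow> g \<in> K \<Longrightarrow> f + g \<in> K"
      "\<And>f c x. f \<in> K \<Longrightarrow> keys c \<subseteq> V \<Longrightarrow> single 0 x \<star> act c f \<in> K" "B \<subseteq> K" and "f \<in> I" for K f
  proof -
    have "\<forall>f. lm f = a \<longrightarrow> f \<in> I \<longrightarrow> f \<in> K" for a
      using wf_exponents[OF V]
    proof (induction a rule: wf_induct_rule)
      case (less a)
      show ?case
      proof (intro allI impI)
        fix f assume f: "lm f = a" "f \<in> I"
        show "f \<in> K"
        proof (cases "f = 0")
          case True
          then show ?thesis using K by simp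
        next
          case False
          then obtain b c where b: "b \<in> B" "lm f = c + lm b" using bspec[OF D(3), of "lm f"] B(3) f by auto
          then have b': "b \<in> I" "b \<noteq> 0" "b \<in> K" using B K by auto
          have cV: "keys c \<subseteq> V" using lmV[OF f(2) False] b by (simp add: keys_add_nat)
          have act: "act c b \<noteq> 0" "lm (act c b) = lm f" using act_lm[OF b'(2)] b by auto
          define x where "x = lookup f (lm f) / lookup (act c b) (lm f)"
          define f' where "f' = f - single 0 x \<star> act c b"
          have nz: "lookup (act c b) (lm f) \<noteq> 0"
            using lm_in_keys[OF act(1)] act(2) by (simp add: in_keys_iff)
          have f'I: "f' \<in> I" unfolding f'_def using act_in b' cV f I by blast
          have "f' \<in> K"
          proof (cases "f' = 0")
            case True
            then show ?thesis using K by simp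
          next
            case False
            have "lm f' \<noteq> lm f"
              using lm_in_keys[OF False] nz
              by (auto simp: f'_def lookup_minus x_def in_keys_iff)
            moreover have "lm f' \<in> keys f \<or> lm f' \<in> keys (act c b)"
              using lm_in_keys[OF False] by (auto simp: f'_def lookup_minus in_keys_iff)
            ultimately have "lm f' < lm f"
              using le_lm[of "lm f'" f] le_lm[of "lm f'" "act c b"] act(2) by auto
            then have "(lm f', a) \<in> {(a, b). a < b \<and> keys a \<subseteq> V \<and> keys b \<subseteq> V}"
              using lmV f f'I False \<open>f \<noteq> 0\<close> by auto
            then show ?thesis using less f'I by blast
          qed
          moreover have "f = f' + single 0 x \<star> act c b" by (simp add: f'_def)
          ultimately show ?thesis using K(2)[OF _ K(3)[OF b'(3) cV], of f'] by metis
        qed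
      qed
    qed
    then show ?thesis using \<open>f \<in> I\<close> by blast
  qed
  then have "\<forall>K. 0 \<in> K \<longrightarrow> (\<forall>f\<in>K. \<forall>g\<in>K. f + g \<in> K) \<longrightarrow>
      (\<forall>f\<in>K. \<forall>c x. keys c \<subseteq> V \<longrightarrow> single 0 x \<star> act c f \<in> K) \<longrightarrow> B \<subseteq> K \<longrightarrow> I \<subseteq> K"
  proof (intro allI impI subsetI)
    fix K f
    assume K: "0 \<in> K" "\<forall>f\<in>K. \<forall>g\<in>K. f + g \<in> K"
      "\<forall>f\<in>K. \<forall>c x. keys c \<subseteq> V \<longrightarrow> single 0 x \<star> act c f \<in> K" "B \<subseteq> K" and f: "f \<in> I"
    show "f \<in> K" by (rule gen[OF _ _ _ _ f]) (use K in blast)+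
  qed
  moreover have "B \<subseteq> I" using B(1) by auto
  ultimately show ?thesis using B(2) by metis
qed

section \<open>The quantum polynomial ring and its ideals\<close>

definition qring :: "nat set \<Rightarrow> ((nat \<Rightarrow>\<^sub>0 nat) \<Rightarrow>\<^sub>0 'k) ring"
  where "qring V = \<lparr>carrier = polys V, monoid.mult = tmul, one = 1, zero = 0, add = (+)\<rparr>"

lemma qring_simps [simp]:
  "carrier (qring V) = polys V" "f \<otimes>\<^bsub>qring V\<^esub> g = f \<star> g" "\<one>\<^bsub>qring V\<^esub> = 1"
  "\<zero>\<^bsub>qring V\<^esub> = 0" "f \<oplus>\<^bsub>qring V\<^esub> g = f + g"
  by (simp_all add: qring_def)

lemma ring_qring: "ring (qring V)"
proof (rule ringI)
  show "abelian_group (qring V)"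
  proof (rule abelian_groupI)
    fix f assume "f \<in> carrier (qring V)"
    then show "\<exists>g\<in>carrier (qring V). g \<oplus>\<^bsub>qring V\<^esub> f = \<zero>\<^bsub>qring V\<^esub>"
      by (intro bexI[of _ "- f"]) (simp_all add: polys_uminus)
  qed (simp_all add: polys_add add_ac)
  show "monoid (qring V)"
    by (rule monoidI) (simp_all add: polys_tmul tmul_assoc)
qed (simp_all add: tmul_distrib_left tmul_distrib_right)

lemma qring_uminus [simp]:
  assumes "f \<in> polys V"
  shows "\<ominus>\<^bsub>qring V\<^esub> f = - f"
proof -
  interpret ring "qring V" by (rule ring_qring)
  show ?thesis using assms by (intro minus_equality) (simp_all add: polys_uminus)
qed

lemma additive_subgroup_qring_iff:
  "additive_subgroup I (qring V) \<longleftrightarrow> I \<subseteq> polys V \<and> 0 \<in> I \<and> (\<forall>f\<in>I. \<forall>g\<in>I. f - g \<in> I)"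
proof
  interpret ring "qring V" by (rule ring_qring)
  assume "additive_subgroup I (qring V)"
  then interpret additive_subgroup I "qring V" .
  have sub: "I \<subseteq> polys V" using a_subset by simp
  moreover have "0 \<in> I" using zero_closed by simp
  moreover have "f - g \<in> I" if "f \<in> I" "g \<in> I" for f g
  proof -
    have "g \<in> polys V" using sub that by blast
    then show ?thesis
      using a_closed[OF that(1) additive_subgroup.a_inv_closed[OF is_additive_subgroup that(2)]] by simp
  qed
  ultimately show "I \<subseteq> polys V \<and> 0 \<in> I \<and> (\<forall>f\<in>I. \<forall>g\<in>I. f - g \<in> I)" by blast
next
  interpret ring "qring V" by (rule ring_qring)
  assume I: "I \<subseteq> polys V \<and> 0 \<in> I \<and> (\<forall>f\<in>I. \<forall>g\<in>I. f - g \<in> I)"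
  then have minus: "- f \<in> I" if "f \<in> I" for f using that by (metis diff_0)
  show "additive_subgroup I (qring V)"
  proof (rule additive_subgroupI, rule group.subgroupI)
    show "Group.group (add_monoid (qring V))" by (rule a_group)
    show "inv\<^bsub>add_monoid (qring V)\<^esub> f \<in> I" if "f \<in> I" for f
      using minus[OF that] qring_uminus[of f V] that I by (auto simp: a_inv_def)
    show "f \<otimes>\<^bsub>add_monoid (qring V)\<^esub> g \<in> I" if "f \<in> I" "g \<in> I" for f g
      using I minus[OF that(2)] that by (metis diff_minus_eq_add monoid.simps(1) qring_simps(5))
  qed (use I in auto)
qed

lemma ideal_qringD:
  assumes "ideal I (qring V)"
  shows "I \<subseteq> polys V" "0 \<in> I" "\<And>f g. f \<in> I \<Longrightarrow> g \<in> I \<Longrightarrow> f - g \<in> I"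
    "\<And>f g. f \<in> I \<Longrightarrow> g \<in> I \<Longrightarrow> f + g \<in> I"
    "\<And>f g. f \<in> I \<Longrightarrow> g \<in> polys V \<Longrightarrow> f \<star> g \<in> I" "\<And>f g. f \<in> I \<Longrightarrow> g \<in> polys V \<Longrightarrow> g \<star> f \<in> I"
proof -
  interpret ideal I "qring V" by fact
  note sub = additive_subgroup_qring_iff[of I V]
  show "I \<subseteq> polys V" "0 \<in> I" "\<And>f g. f \<in> I \<Longrightarrow> g \<in> I \<Longrightarrow> f - g \<in> I"
    using sub is_additive_subgroup by auto
  show "\<And>f g. f \<in> I \<Longrightarrow> g \<in> I \<Longrightarrow> f + g \<in> I"
    using additive_subgroup.a_closed[OF is_additive_subgroup] by simp
  show "\<And>f g. f \<in> I \<Longrightarrow> g \<in> polys V \<Longrightarrow> f \<star> g \<in> I" using I_r_closed by simp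
  show "\<And>f g. f \<in> I \<Longrightarrow> g \<in> polys V \<Longrightarrow> g \<star> f \<in> I" using I_l_closed by simp
qed

lemma ideal_qringI:
  assumes "I \<subseteq> polys V" "0 \<in> I" "\<And>f g. f \<in> I \<Longrightarrow> g \<in> I \<Longrightarrow> f - g \<in> I"
    "\<And>f g. f \<in> I \<Longrightarrow> g \<in> polys V \<Longrightarrow> f \<star> g \<in> I" "\<And>f g. f \<in> I \<Longrightarrow> g \<in> polys V \<Longrightarrow> g \<star> f \<in> I"
  shows "ideal I (qring V)"
proof -
  have "additive_subgroup I (qring V)" using assms by (simp add: additive_subgroup_qring_iff)
  then show ?thesis
    using assms ring_qring by (auto intro!: idealI simp: additive_subgroup_def)
qed

lemma lr_noetherian_qring:
  assumes "finite V"
  shows "lr_noetherian_ring (qring V)"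
proof -
  interpret ring "qring V" by (rule ring_qring)
  show ?thesis
  proof
    fix I assume left: "left_ideal I (qring V)"
    then have I: "I \<subseteq> polys V" "\<And>f g. f \<in> I \<Longrightarrow> g \<in> I \<Longrightarrow> f - g \<in> I"
        and mult: "\<And>f g. f \<in> I \<Longrightarrow> g \<in> polys V \<Longrightarrow> g \<star> f \<in> I"
      using additive_subgroup_qring_iff[of I V] left_ideal.left_closed[OF left]
      by (auto simp: left_ideal_def)
    obtain B where B: "B \<subseteq> I" "finite B" and gen: "\<And>K. 0 \<in> K \<Longrightarrow> \<forall>f\<in>K. \<forall>g\<in>K. f + g \<in> K \<Longrightarrow>
        \<forall>f\<in>K. \<forall>c x. keys c \<subseteq> V \<longrightarrow> single 0 x \<star> (single c 1 \<star> f) \<in> K \<Longrightarrow> B \<subseteq> K \<Longrightarrow> I \<subseteq> K"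
      using leading_monomial_generation[OF assms I, of "\<lambda>c f. single c 1 \<star> f"] mult
      by (auto simp: lm_tmul polys_single lm_def[of "single _ _"])
    have "I = left_span (qring V) B"
      unfolding left_span_def
    proof (intro equalityI Inter_lower Inter_greatest)
      fix K assume "K \<in> {K. left_ideal K (qring V) \<and> B \<subseteq> K}"
      then have K: "left_ideal K (qring V)" "B \<subseteq> K" by auto
      interpret K: left_ideal K "qring V" by fact
      show "I \<subseteq> K"
        using K.zero_closed K.a_closed K.left_closed K(2) by (intro gen) (simp_all add: polys_single)
    qed (use left B in auto)
    then show "\<exists>A\<subseteq>carrier (qring V). finite A \<and> I = left_span (qring V) A"
      using B I by auto
  next
    fix I assume right: "right_ideal I (qring V)"
    then have I: "I \<subseteq> polys V" "\<And>f g. f \<in> I \<Longrightarrow> g \<in> I \<Longrightarrow> f - g \<in> I"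
        and mult: "\<And>f g. f \<in> I \<Longrightarrow> g \<in> polys V \<Longrightarrow> f \<star> g \<in> I"
      using additive_subgroup_qring_iff[of I V] right_ideal.right_closed[OF right]
      by (auto simp: right_ideal_def)
    obtain B where B: "B \<subseteq> I" "finite B" and gen: "\<And>K. 0 \<in> K \<Longrightarrow> \<forall>f\<in>K. \<forall>g\<in>K. f + g \<in> K \<Longrightarrow>
        \<forall>f\<in>K. \<forall>c x. keys c \<subseteq> V \<longrightarrow> single 0 x \<star> (f \<star> single c 1) \<in> K \<Longrightarrow> B \<subseteq> K \<Longrightarrow> I \<subseteq> K"
      using leading_monomial_generation[OF assms I, of "\<lambda>c f. f \<star> single c 1"] mult
      by (auto simp: lm_tmul polys_single lm_def[of "single _ _"] add.commute scalar_commute[symmetric])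
    have "I = right_span (qring V) B"
      unfolding right_span_def
    proof (intro equalityI Inter_lower Inter_greatest)
      fix K assume "K \<in> {K. right_ideal K (qring V) \<and> B \<subseteq> K}"
      then have K: "right_ideal K (qring V)" "B \<subseteq> K" by auto
      interpret K: right_ideal K "qring V" by fact
      show "I \<subseteq> K"
        using K.zero_closed K.a_closed K.right_closed K(2)
        by (intro gen) (simp_all add: polys_single scalar_commute[symmetric])
    qed (use right B in auto)
    then show "\<exists>A\<subseteq>carrier (qring V). finite A \<and> I = right_span (qring V) A"
      using B I by auto
  qed
qed

section \<open>Principal ideals and prime ideals\<close>

definition principal :: "nat set \<Rightarrow> ((nat \<Rightarrow>\<^sub>0 nat) \<Rightarrow>\<^sub>0 'k) \<Rightarrow> ((nat \<Rightarrow>\<^sub>0 nat) \<Rightarrow>\<^sub>0 'k) set"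
  where "principal V f = {f \<star> u |u. u \<in> polys V}"

lemma polys_keys_cong: "keys f = keys g \<Longrightarrow> f \<in> polys V \<longleftrightarrow> g \<in> polys V"
  by (simp add: polys_def)

lemma mem_principal_left:
  assumes "homogeneous f" "u \<in> polys V"
  shows "u \<star> f \<in> principal V f"
proof -
  obtain v where "keys v = keys u" "u \<star> f = f \<star> v"
    using homogeneous_normal_left[OF assms(1)] by blast
  then show ?thesis using assms(2) polys_keys_cong[of v u V] by (auto simp: principal_def)
qed

lemma self_mem_principal: "f \<in> principal V f"
  unfolding principal_def by (intro CollectI exI[of _ 1]) simp

lemma principal_eq_divides:
  assumes "f \<noteq> 0" "g \<in> polys V"
  shows "g \<in> principal V f \<longleftrightarrow> f divides g"
proof
  assume "f divides g"
  then obtain s where s: "g = f \<star> s" by (auto simp: divides_def)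
  then have "s \<in> polys V"
    using polys_factors(2)[of f s V] assms by (cases "s = 0") auto
  then show "g \<in> principal V f" using s by (auto simp: principal_def)
qed (auto simp: principal_def divides_def)

lemma ideal_principal:
  assumes f: "f \<in> polys V" "homogeneous f"
  shows "ideal (principal V f) (qring V)"
proof (rule ideal_qringI)
  show "principal V f \<subseteq> polys V" using f by (auto simp: principal_def polys_tmul)
  show "0 \<in> principal V f" using tmul_zero_right[of f] by (force simp: principal_def)
  show "g - h \<in> principal V f" if "g \<in> principal V f" "h \<in> principal V f" for g h
    using that unfolding principal_def mem_Collect_eq by (metis tmul_diff_right polys_diff)
  show "g \<star> h \<in> principal V f" if "g \<in> principal V f" "h \<in> polys V" for g h
    using that unfolding principal_def mem_Collect_eq by (metis tmul_assoc polys_tmul)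
  show "h \<star> g \<in> principal V f" if gh: "g \<in> principal V f" "h \<in> polys V" for g h
  proof -
    obtain u where u: "u \<in> polys V" "g = f \<star> u" using gh(1) by (auto simp: principal_def)
    obtain h' where h': "keys h' = keys h" "h \<star> f = f \<star> h'"
      using homogeneous_normal_left[OF f(2)] by blast
    then have "h \<star> g = f \<star> (h' \<star> u)" using u by (simp flip: tmul_assoc)
    moreover have "h' \<in> polys V" using gh(2) h'(1) polys_keys_cong by blast
    ultimately show ?thesis using u by (auto simp: principal_def polys_tmul)
  qed
qed

lemma normal_principal_qring:
  assumes f: "f \<in> polys V" "homogeneous f"
  shows "normal_principal (qring V) (principal V f)"
proof -
  interpret ring "qring V" by (rule ring_qring)
  have "carrier (qring V) #>\<^bsub>qring V\<^esub> f = f <#\<^bsub>qring V\<^esub> carrier (qring V)"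
    unfolding r_coset_def l_coset_def
  proof (intro equalityI subsetI)
    fix g assume "g \<in> (\<Union>h\<in>carrier (qring V). {h \<otimes>\<^bsub>qring V\<^esub> f})"
    then obtain u where u: "u \<in> polys V" "g = u \<star> f" by auto
    then have "g \<in> principal V f" using mem_principal_left f by simp
    then show "g \<in> (\<Union>h\<in>carrier (qring V). {f \<otimes>\<^bsub>qring V\<^esub> h})" by (auto simp: principal_def)
  next
    fix g assume "g \<in> (\<Union>h\<in>carrier (qring V). {f \<otimes>\<^bsub>qring V\<^esub> h})"
    then obtain u where u: "u \<in> polys V" "g = f \<star> u" by auto
    obtain v where "keys v = keys u" "f \<star> u = v \<star> f" using homogeneous_normal_right[OF f(2)] by blast
    then show "g \<in> (\<Union>h\<in>carrier (qring V). {h \<otimes>\<^bsub>qring V\<^esub> f})"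
      using u polys_keys_cong[of v u V] by auto
  qed
  then have "normal_element (qring V) f" using f by (simp add: normal_element_def)
  moreover have "principal V f = Idl\<^bsub>qring V\<^esub> {f}"
  proof
    have "f \<in> Idl\<^bsub>qring V\<^esub> {f}" using genideal_self'[of f] f by simp
    moreover have "ideal (Idl\<^bsub>qring V\<^esub> {f}) (qring V)" using genideal_ideal[of "{f}"] f by simp
    ultimately show "principal V f \<subseteq> Idl\<^bsub>qring V\<^esub> {f}"
      using ideal_qringD(5) by (auto simp: principal_def)
    show "Idl\<^bsub>qring V\<^esub> {f} \<subseteq> principal V f"
      using genideal_minimal[OF ideal_principal[OF f]] self_mem_principal by simp
  qed
  ultimately show ?thesis unfolding normal_principal_def by blast
qed

lemma one_notin_principal:
  assumes "\<not> scalar f"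
  shows "1 \<notin> principal V f"
proof
  assume "1 \<in> principal V f"
  then obtain u where u: "1 = f \<star> u" by (auto simp: principal_def)
  then have nz: "f \<noteq> 0" "u \<noteq> 0" by (auto simp del: one_neq_zero simp: one_neq_zero[symmetric])
  then have "f \<in> polys {}" using polys_factors(1)[of f u "{}"] u by (metis polys_one)
  then show False using assms by (simp add: scalar_def)
qed

lemma nc_prime_ideal_qringI:
  assumes P: "ideal P (qring V)" "1 \<notin> P"
    and prime: "\<And>I J. ideal I (qring V) \<Longrightarrow> ideal J (qring V) \<Longrightarrow> \<not> I \<subseteq> P \<Longrightarrow> \<not> J \<subseteq> P \<Longrightarrow>
      \<exists>f\<in>I. \<exists>g\<in>J. f \<star> g \<notin> P"
  shows "nc_prime_ideal P (qring V)"
proof -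
  interpret ideal P "qring V" by fact
  show ?thesis
  proof
    show "P \<noteq> carrier (qring V)" using P(2) polys_one by auto
    fix I J assume IJ: "ideal I (qring V)" "ideal J (qring V)" "I \<cdot>\<^bsub>qring V\<^esub> J \<subseteq> P"
    then have "f \<star> g \<in> P" if "f \<in> I" "g \<in> J" for f g
      using ideal_prod.prod[of f I g J "qring V"] that by auto
    then show "I \<subseteq> P \<or> J \<subseteq> P" using prime IJ by blast
  qed
qed

lemma completely_prime_imp_prime:
  assumes P: "ideal P (qring V)" "1 \<notin> P"
    and prime: "\<And>f g. f \<in> polys V \<Longrightarrow> g \<in> polys V \<Longrightarrow> f \<star> g \<in> P \<Longrightarrow> f \<in> P \<or> g \<in> P"
  shows "nc_prime_ideal P (qring V)"
proof (rule nc_prime_ideal_qringI[OF P])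
  fix I J assume "ideal I (qring V)" "ideal J (qring V)" "\<not> I \<subseteq> P" "\<not> J \<subseteq> P"
  then obtain f g where "f \<in> I" "f \<notin> P" "g \<in> J" "g \<notin> P" "f \<in> polys V" "g \<in> polys V"
    using ideal_qringD(1) by blast
  then show "\<exists>f\<in>I. \<exists>g\<in>J. f \<star> g \<notin> P" using prime by blast
qed

lemma ideal_zero_qring: "ideal {0} (qring V)"
  by (rule ideal_qringI) simp_all

lemma nc_prime_ring_qring: "nc_prime_ring (qring V)"
proof -
  have "nc_prime_ideal {0} (qring V)"
    by (rule completely_prime_imp_prime) (simp_all add: ideal_zero_qring)
  then show ?thesis by (simp add: nc_prime_ring_def ring_qring)
qed

abbreviation var :: "nat \<Rightarrow> (nat \<Rightarrow>\<^sub>0 nat) \<Rightarrow>\<^sub>0 'k"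
  where "var v \<equiv> var_power v 1"

lemma var_factor_right_iff: "(\<exists>l. f = l \<star> var v) \<longleftrightarrow> (\<forall>a\<in>keys f. lookup a v > 0)"
proof
  assume "\<exists>l. f = l \<star> var v"
  then show "\<forall>a\<in>keys f. lookup a v > 0" by (auto simp: keys_tmul_single lookup_add)
next
  assume pos: "\<forall>a\<in>keys f. lookup a v > 0"
  show "\<exists>l. f = l \<star> var v"
  proof (rule right_factor_monomial)
    fix a assume "a \<in> keys f"
    then have "lookup a v > 0" using pos by blast
    then have "a = a - single v 1 + single v 1"
      by (intro poly_mapping_eqI) (auto simp: lookup_add lookup_minus lookup_single when_def)
    then show "\<exists>c. a = c + single v 1" by blast
  qed
qed

lemma var_divides_iff: "var v divides f \<longleftrightarrow> (\<forall>a\<in>keys f. lookup a v > 0)"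
proof -
  have "(\<exists>l. f = l \<star> var v) \<longleftrightarrow> (\<exists>l. f = var v \<star> l)"
    using homogeneous_normal_left[of "var v"] homogeneous_normal_right[of "var v"]
    by (metis homogeneous_single)
  then show ?thesis unfolding divides_def var_factor_right_iff[symmetric] by simp
qed

text \<open>
  The terms in which \<open>x\<^sub>v\<close> does not occur multiply among themselves, and the
  algebra is a domain.
\<close>
lemma var_prime:
  assumes "var v divides f \<star> g"
  shows "var v divides f \<or> var v divides g"
proof -
  let ?P = "\<lambda>a. lookup a v = 0"
  have "restr ?P (f \<star> g) = restr ?P f \<star> restr ?P g"
    by (rule restr_tmul) (simp add: lookup_add)
  moreover have "restr ?P h = 0 \<longleftrightarrow> var v divides h" for h
    unfolding var_divides_iff restr_eq_0_iff by auto
  ultimately show ?thesis using assms by (metis tmul_eq_0_iff)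
qed

lemma not_scalar_var: "\<not> scalar (var v)"
proof
  assume "scalar (var v)"
  then have "single v 1 = (0 :: nat \<Rightarrow>\<^sub>0 nat)" by (auto simp: scalar_def polys_def)
  then show False by (metis lookup_single_eq lookup_zero one_neq_zero)
qed

lemma var_in_polys: "v \<in> V \<Longrightarrow> var v \<in> polys V"
  by (intro polys_single) auto

lemma nc_prime_ideal_var:
  assumes "v \<in> V"
  shows "nc_prime_ideal (principal V (var v)) (qring V)"
proof (rule completely_prime_imp_prime)
  show "ideal (principal V (var v)) (qring V)"
    using var_in_polys[OF assms] by (intro ideal_principal) auto
  show "1 \<notin> principal V (var v)" using one_notin_principal not_scalar_var by blast
  show "f \<in> principal V (var v) \<or> g \<in> principal V (var v)"
    if "f \<in> polys V" "g \<in> polys V" "f \<star> g \<in> principal V (var v)" for f g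
    using that var_prime[of v f g] by (simp add: principal_eq_divides polys_tmul)
qed

text \<open>
  Strip the variables of \<open>x\<^sup>c\<close> one by one: each of them is prime and does not
  divide \<open>f\<close>, so it divides the cofactor of \<open>f\<close>.
\<close>
lemma monomial_cancel:
  assumes f: "\<And>v. v \<in> V \<Longrightarrow> \<not> var v divides f" and c: "keys c \<subseteq> V"
    and g: "f divides g \<star> single c 1"
  shows "f divides g"
  using c g
proof (induction "exponent_degree c" arbitrary: c rule: less_induct)
  case less
  show ?case
  proof (cases "c = 0")
    case True
    then show ?thesis using less.prems by simp
  next
    case False
    then obtain v where v: "v \<in> keys c" using ex_key by blast
    define c' where "c' = c - single v 1"
    have c': "c = c' + single v 1"
      using v by (intro poly_mapping_eqI) (auto simp: c'_def lookup_add lookup_minus lookup_single when_def in_keys_iff)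
    have keys: "keys c' \<subseteq> V" "v \<in> V" using c' less.prems v by (auto simp: keys_add_nat)
    have "single c 1 = single 0 (1 / q c' (single v 1)) \<star> (single c' 1 \<star> var v)"
      by (simp add: c' tmul_single_single)
    then have "g \<star> single c 1 = single 0 (1 / q c' (single v 1)) \<star> (g \<star> single c' 1 \<star> var v)"
      by (simp only: tmul_assoc[symmetric] scalar_commute)
    then have "f divides g \<star> single c' 1 \<star> var v"
      using less.prems(2) divides_scalar_iff[of "1 / q c' (single v 1)" f "g \<star> single c' 1 \<star> var v"] by simp
    then obtain s where s: "g \<star> single c' 1 \<star> var v = f \<star> s" by (auto simp: divides_def)
    have "var v divides g \<star> single c' 1 \<star> var v"
      by (intro divides_tmul_left) auto
    then have "var v divides s" using var_prime[of v f s] f[OF keys(2)] s by simp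
    then obtain s' where "s = s' \<star> var v" using var_divides_iff var_factor_right_iff by blast
    then have "g \<star> single c' 1 \<star> var v = (f \<star> s') \<star> var v" using s by (simp add: tmul_assoc)
    then have "g \<star> single c' 1 = f \<star> s'" by (subst (asm) tmul_right_cancel) auto
    then have "f divides g \<star> single c' 1" by (auto simp: divides_def)
    moreover have "exponent_degree c' < exponent_degree c"
    proof -
      have "exponent_degree (single v 1 :: nat \<Rightarrow>\<^sub>0 nat) = 1" by (simp add: exponent_degree_def)
      then show ?thesis using c' by (simp add: exponent_degree_add)
    qed
    ultimately show ?thesis using less.hyps keys by blast
  qed
qed

end

section \<open>Unique factorization\<close>

text \<open>
  The second assumption says that the variables in \<open>V\<close> detect all differences of
  commutation characters, so that an ideal of \<open>qring V\<close> is able to separate the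
  graded components of its elements.
\<close>
locale quantum_affine_space = quantum_space q for q :: "(nat \<Rightarrow>\<^sub>0 nat) \<Rightarrow> (nat \<Rightarrow>\<^sub>0 nat) \<Rightarrow> 'k::field" +
  fixes V :: "nat set"
  assumes finite_V: "finite V"
    and comm_factor_restr: "comm_factor a (restr (\<lambda>i. i \<in> V) b) = comm_factor a b"
begin

text \<open>
  Take \<open>g \<in> I - K\<close> with the fewest terms. If two terms had different characters,
  a monomial \<open>X\<close> would distinguish them. Then \<open>X g\<close> minus a suitable
  multiple of \<open>g X\<close> loses the first term, and another multiple loses the second, so
  both elements lie in \<open>K\<close> by minimality. Their difference is a nonzero multiple of
  \<open>g X\<close>, so \<open>g \<in> K\<close>.
\<close>
lemma homogeneous_outside:
  assumes K: "ideal K (qring V)"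
    and cancel: "\<And>g c. g \<in> polys V \<Longrightarrow> keys c \<subseteq> V \<Longrightarrow> g \<star> single c 1 \<in> K \<Longrightarrow> g \<in> K"
    and I: "ideal I (qring V)" "\<not> I \<subseteq> K"
  shows "\<exists>g\<in>I. homogeneous g \<and> g \<notin> K"
proof -
  note K = ideal_qringD[OF K] and I = I(2) ideal_qringD[OF I(1)]
  obtain g0 where "g0 \<in> I - K" using I(1) by blast
  then obtain g where g: "g \<in> I" "g \<notin> K" and min: "\<And>h. h \<in> I \<Longrightarrow> h \<notin> K \<Longrightarrow> card (keys g) \<le> card (keys h)"
    using ex_has_least_nat[of "\<lambda>g. g \<in> I - K" g0 "\<lambda>g. card (keys g)"] by blast
  have gV: "g \<in> polys V" using g I by blast
  have "homogeneous g"
  proof (rule ccontr)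
    assume "\<not> homogeneous g"
    then obtain a b c where ab: "a \<in> keys g" "b \<in> keys g" "comm_factor a c \<noteq> comm_factor b c"
      by (auto simp: homogeneous_def same_character_def)
    define d where "d = restr (\<lambda>i. i \<in> V) c"
    have d: "keys d \<subseteq> V" "comm_factor a d \<noteq> comm_factor b d"
      using ab(3) by (auto simp: d_def keys_restr comm_factor_restr)
    let ?X = "single d 1"
    \<comment> \<open>The term of \<open>g\<close> at \<open>x\<close> cancels in \<open>t x\<close>.\<close>
    define t where "t x = ?X \<star> g - single 0 (comm_factor d x) \<star> (g \<star> ?X)" for x
    have X: "?X \<in> polys V" using d by (simp add: polys_single)
    have tK: "t x \<in> K" if x: "x \<in> keys g" for x
    proof (rule ccontr)
      assume "t x \<notin> K"
      moreover have "t x \<in> I" unfolding t_def using I g X by auto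
      ultimately have "card (keys g) \<le> card (keys (t x))" using min by blast
      moreover have "keys (t x) \<subseteq> (\<lambda>y. y + d) ` (keys g - {x})"
      proof
        fix z assume z: "z \<in> keys (t x)"
        then have "z \<in> keys (?X \<star> g) \<or> z \<in> keys (g \<star> ?X)"
          by (auto simp: t_def in_keys_iff lookup_minus)
        then obtain y where y: "y \<in> keys g" "z = y + d"
          using keys_tmul[of ?X g] keys_tmul[of g ?X] by (auto simp: add.commute split: if_splits)
        have "lookup (t x) (x + d) = 0"
          using lookup_tmul_single_left[of d 1 g x] lookup_tmul_single_right[of g d 1 x]
          by (simp add: t_def lookup_minus comm_factor_def add.commute)
        then show "z \<in> (\<lambda>y. y + d) ` (keys g - {x})" using y z by (auto simp: in_keys_iff)
      qed
      then have "card (keys (t x)) \<le> card (keys g - {x})"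
        by (meson card_image_le card_mono finite_Diff finite_imageI finite_keys le_trans)
      moreover have "card (keys g - {x}) < card (keys g)" using x by (intro psubset_card_mono) auto
      ultimately show False by simp
    qed
    define e where "e = comm_factor d b - comm_factor d a"
    have "e \<noteq> 0" using d(2) comm_factor_swap[of d a] comm_factor_swap[of d b] by (auto simp: e_def)
    have "t a - t b \<in> K" using K(3)[OF tK[OF ab(1)] tK[OF ab(2)]] .
    moreover have "t a - t b = single 0 e \<star> (g \<star> ?X)"
      by (simp add: t_def e_def single_diff tmul_diff_left)
    ultimately have "single 0 e \<star> (g \<star> ?X) \<in> K" by simp
    then have "single 0 (1 / e) \<star> (single 0 e \<star> (g \<star> ?X)) \<in> K" using K(6) by simp
    then have "g \<star> ?X \<in> K" using \<open>e \<noteq> 0\<close> by (simp add: scalar_scalar)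
    then show False using cancel[OF gV d(1)] g(2) by blast
  qed
  then show ?thesis using g by blast
qed

text \<open>
  Two ideals that are not contained in \<open>(f)\<close> contain homogeneous elements outside of
  \<open>(f)\<close>, and \<open>f\<close> is prime among homogeneous elements. That
  \<open>f\<close> is not divisible by a variable is used to cancel monomials modulo
  \<open>f\<close>.
\<close>
lemma nc_prime_ideal_irreducible:
  assumes f: "f \<in> polys V" "irreducible f" "\<And>v. v \<in> V \<Longrightarrow> \<not> var v divides f"
  shows "nc_prime_ideal (principal V f) (qring V)"
proof (rule nc_prime_ideal_qringI)
  have f': "homogeneous f" "\<not> scalar f" "f \<noteq> 0" using f irreducible_nonzero by (auto simp: irreducible_def)
  show ideal: "ideal (principal V f) (qring V)" using f f' by (intro ideal_principal)
  show "1 \<notin> principal V f" using one_notin_principal f' by blast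
  have cancel: "g \<in> principal V f" if "g \<in> polys V" "keys c \<subseteq> V" "g \<star> single c 1 \<in> principal V f" for g c
    using that monomial_cancel[OF f(3) that(2), of g] f' by (simp add: principal_eq_divides polys_tmul polys_single)
  fix I J assume IJ: "ideal I (qring V)" "ideal J (qring V)" "\<not> I \<subseteq> principal V f" "\<not> J \<subseteq> principal V f"
  have outside: "\<exists>g\<in>I. homogeneous g \<and> g \<notin> principal V f"
    if "ideal I (qring V)" "\<not> I \<subseteq> principal V f" for I
    by (rule homogeneous_outside[OF ideal _ that]) (rule cancel)
  obtain g where g: "g \<in> I" "homogeneous g" "g \<notin> principal V f"
    using outside[OF IJ(1,3)] by blast
  obtain h where h: "h \<in> J" "homogeneous h" "h \<notin> principal V f"
    using outside[OF IJ(2,4)] by blast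
  have gh: "g \<in> polys V" "h \<in> polys V" using g h IJ ideal_qringD(1) by blast+
  have "g \<star> h \<notin> principal V f"
    using irreducible_imp_prime[OF finite_V f(1,2)] g h gh f'(3)
    by (auto simp: principal_eq_divides polys_tmul prime_in_def)
  then show "\<exists>g\<in>I. \<exists>h\<in>J. g \<star> h \<notin> principal V f" using g h by blast
qed

text \<open>
  For normal elements \<open>g\<close> and \<open>h\<close> the product of the ideals they
  generate is generated by \<open>g h\<close>.
\<close>
lemma nc_prime_ideal_homogeneous_prime:
  assumes P: "nc_prime_ideal P (qring V)" and g: "g \<in> polys V" "homogeneous g" and h: "h \<in> polys V" "homogeneous h"
    and gh: "g \<star> h \<in> P"
  shows "g \<in> P \<or> h \<in> P"
proof -
  interpret nc_prime_ideal P "qring V" by fact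
  note PD = ideal_qringD[OF is_ideal]
  have prods: "i \<star> j \<in> P" if ij: "i \<in> principal V g" "j \<in> principal V h" for i j
  proof -
    obtain u w where u: "u \<in> polys V" "i = g \<star> u" and w: "w \<in> polys V" "j = h \<star> w"
      using ij by (auto simp: principal_def)
    obtain u' where u': "keys u' = keys u" "u \<star> h = h \<star> u'" using homogeneous_normal_left[OF h(2)] by blast
    have "i \<star> j = g \<star> (u \<star> h) \<star> w" by (simp add: u w tmul_assoc)
    also have "\<dots> = (g \<star> h) \<star> (u' \<star> w)" by (simp add: u' tmul_assoc)
    finally show ?thesis using PD(5)[OF gh, of "u' \<star> w"] polys_keys_cong[OF u'(1), of V] u w by (simp add: polys_tmul)
  qed
  have "principal V g \<cdot>\<^bsub>qring V\<^esub> principal V h \<subseteq> P"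
  proof
    fix x assume "x \<in> principal V g \<cdot>\<^bsub>qring V\<^esub> principal V h"
    then show "x \<in> P" by induction (simp_all add: prods PD(4))
  qed
  then have "principal V g \<subseteq> P \<or> principal V h \<subseteq> P"
    using prime ideal_principal g h by blast
  then show ?thesis using self_mem_principal by blast
qed

text \<open>
  Let \<open>P\<close> be a nonzero prime ideal. Either it contains a variable, which generates a
  prime ideal, or a nonzero homogeneous element of least total degree in \<open>P\<close> does: it
  is irreducible, because in a factorization one factor lies in \<open>P\<close> again and the
  other one is left with degree 0.
\<close>
theorem noetherian_UFR_qring: "noetherian_UFR (qring V)"
  unfolding noetherian_UFR_def
proof (intro conjI allI impI)
  show "lr_noetherian_ring (qring V)" using finite_V by (rule lr_noetherian_qring)
  show "nc_prime_ring (qring V)" by (rule nc_prime_ring_qring)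
  fix P assume P: "nc_prime_ideal P (qring V) \<and> P \<noteq> {\<zero>\<^bsub>qring V\<^esub>}"
  then interpret nc_prime_ideal P "qring V" by simp
  note PD = ideal_qringD[OF is_ideal]
  have sub: "principal V f \<subseteq> P" if "f \<in> P" for f using PD(5)[OF that] by (auto simp: principal_def)
  have nonzero: "principal V f \<noteq> {\<zero>\<^bsub>qring V\<^esub>}" if "f \<noteq> 0" for f
    using self_mem_principal[of f V] that by auto
  have one: "1 \<notin> P"
  proof
    assume "1 \<in> P"
    then have "P = polys V" using PD(1) PD(5)[of 1] by auto
    then show False using proper by simp
  qed
  show "\<exists>Q. nc_prime_ideal Q (qring V) \<and> normal_principal (qring V) Q \<and> Q \<noteq> {\<zero>\<^bsub>qring V\<^esub>} \<and> Q \<subseteq> P"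
  proof (cases "\<exists>v\<in>V. var v \<in> P")
    case True
    then obtain v where v: "v \<in> V" "var v \<in> P" by blast
    then show ?thesis
      using nc_prime_ideal_var normal_principal_qring var_in_polys sub nonzero[of "var v"]
      by (intro exI[of _ "principal V (var v)"]) auto
  next
    case False
    have "\<not> P \<subseteq> {0}" using P PD(2) by auto
    then obtain f0 where "f0 \<in> P" "homogeneous f0" "f0 \<notin> {0}"
      using homogeneous_outside[OF ideal_zero_qring _ is_ideal] by auto
    then obtain f where f: "f \<in> P" "homogeneous f" "f \<noteq> 0"
      and min: "\<And>g. g \<in> P \<Longrightarrow> homogeneous g \<Longrightarrow> g \<noteq> 0 \<Longrightarrow> total_degree f \<le> total_degree g"
      using ex_has_least_nat[of "\<lambda>f. f \<in> P \<and> homogeneous f \<and> f \<noteq> 0" f0 total_degree] by blast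
    have fV: "f \<in> polys V" using f PD by blast
    have unscale: "g \<in> P" if gs: "scalar s" "g \<star> s \<in> P" "g \<star> s \<noteq> 0" for g s
    proof -
      obtain c where c: "s = single 0 c" "c \<noteq> 0" using gs by (auto simp: scalar_iff)
      have "g \<star> s \<star> single 0 (1 / c) \<in> P" using PD(5) gs by simp
      then show ?thesis using c by (simp add: tmul_assoc tmul_single_single)
    qed
    have "\<not> scalar f" using unscale[of f 1] f one by auto
    moreover have "scalar g \<or> scalar h" if gh: "homogeneous g" "homogeneous h" "f = g \<star> h" for g h
    proof -
      have nz: "g \<noteq> 0" "h \<noteq> 0" using gh f by auto
      have "g \<in> polys V" "h \<in> polys V" using polys_factors[of g h V] fV nz gh by auto
      then have "g \<in> P \<or> h \<in> P"
        using nc_prime_ideal_homogeneous_prime[of P g h] gh f P by simp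
      then have "total_degree f \<le> total_degree g \<or> total_degree f \<le> total_degree h" using min gh nz by blast
      then show ?thesis using total_degree_tmul[OF nz] gh by (auto simp: scalar_iff_total_degree)
    qed
    ultimately have irr: "irreducible f" using f by (auto simp: irreducible_def)
    have "\<not> var v divides f" if v: "v \<in> V" for v
    proof
      assume "var v divides f"
      then obtain s where s: "f = var v \<star> s" by (auto simp: divides_def)
      then have "homogeneous s" using homogeneous_cofactor[of "var v" s] f by simp
      then have "scalar s" using irr s not_scalar_var unfolding irreducible_def by (metis homogeneous_single)
      then show False using unscale[of s "var v"] f s v False by auto
    qed
    then have "nc_prime_ideal (principal V f) (qring V)"
      using fV irr by (intro nc_prime_ideal_irreducible)
    then show ?thesis
      using normal_principal_qring[OF fV f(2)] sub[OF f(1)] nonzero[OF f(3)] by blast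
  qed
qed

end

section \<open>Invariance under isomorphism\<close>

text \<open>
  The inverse \<open>k\<close> is a parameter so that every statement on images under
  \<open>h\<close> can be used for \<open>k\<close> as well.
\<close>
locale ring_isomorphism = R: ring R + S: ring S
  for R :: "('a, 'm) ring_scheme" (structure) and S :: "('b, 'n) ring_scheme" (structure) +
  fixes h :: "'a \<Rightarrow> 'b" and k :: "'b \<Rightarrow> 'a"
  assumes h_hom: "h \<in> ring_hom R S" and k_hom: "k \<in> ring_hom S R"
    and k_h: "x \<in> carrier R \<Longrightarrow> k (h x) = x" and h_k: "y \<in> carrier S \<Longrightarrow> h (k y) = y"
begin

lemma inverse_isomorphism: "ring_isomorphism S R k h"
  by unfold_locales (fact h_hom k_hom k_h h_k)+

lemma h_closed: "x \<in> carrier R \<Longrightarrow> h x \<in> carrier S"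
  and k_closed: "y \<in> carrier S \<Longrightarrow> k y \<in> carrier R"
  using h_hom k_hom by (auto intro: ring_hom_closed)

lemma h_mult: "x \<in> carrier R \<Longrightarrow> y \<in> carrier R \<Longrightarrow> h (x \<otimes>\<^bsub>R\<^esub> y) = h x \<otimes>\<^bsub>S\<^esub> h y"
  and h_add: "x \<in> carrier R \<Longrightarrow> y \<in> carrier R \<Longrightarrow> h (x \<oplus>\<^bsub>R\<^esub> y) = h x \<oplus>\<^bsub>S\<^esub> h y"
  using h_hom by (auto intro: ring_hom_mult ring_hom_add)

lemma h_zero: "h \<zero>\<^bsub>R\<^esub> = \<zero>\<^bsub>S\<^esub>"
  using h_hom R.ring_axioms S.ring_axioms by (rule ring_hom_zero)

lemma k_image_h_image:
  assumes "I \<subseteq> carrier R"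
  shows "k ` h ` I = I"
proof -
  have "(\<lambda>x. k (h x)) ` I = (\<lambda>x. x) ` I"
    using assms k_h by (intro image_cong) auto
  then show ?thesis by (simp add: image_image)
qed

lemma h_image_carrier: "h ` carrier R = carrier S"
  using h_closed k_closed h_k by (metis image_eqI image_subsetI subsetI subset_antisym)

lemma additive_subgroup_image:
  assumes "additive_subgroup I R"
  shows "additive_subgroup (h ` I) S"
proof -
  interpret ring_hom_ring R S h
    using R.ring_axioms S.ring_axioms h_hom by (rule ring_hom_ringI2)
  show ?thesis
    using img_is_add_subgroup additive_subgroup.a_subgroup[OF assms] by (intro additive_subgroupI)
qed

lemma left_ideal_image:
  assumes "left_ideal I R"
  shows "left_ideal (h ` I) S"
proof -
  interpret left_ideal I R by fact
  interpret img: additive_subgroup "h ` I" S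
    using additive_subgroup_image additive_subgroup_axioms by blast
  show ?thesis
  proof
    fix a x assume "a \<in> h ` I" "x \<in> carrier S"
    then obtain b where "b \<in> I" "a = h b" by blast
    then have "x \<otimes>\<^bsub>S\<^esub> a = h (k x \<otimes>\<^bsub>R\<^esub> b)"
      using \<open>x \<in> carrier S\<close> by (simp add: h_mult h_k k_closed)
    then show "x \<otimes>\<^bsub>S\<^esub> a \<in> h ` I"
      using \<open>b \<in> I\<close> \<open>x \<in> carrier S\<close> by (simp add: left_closed k_closed)
  qed
qed

lemma right_ideal_image:
  assumes "right_ideal I R"
  shows "right_ideal (h ` I) S"
proof -
  interpret right_ideal I R by fact
  interpret img: additive_subgroup "h ` I" S
    using additive_subgroup_image additive_subgroup_axioms by blast
  show ?thesis
  proof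
    fix a x assume "a \<in> h ` I" "x \<in> carrier S"
    then obtain b where "b \<in> I" "a = h b" by blast
    then have "a \<otimes>\<^bsub>S\<^esub> x = h (b \<otimes>\<^bsub>R\<^esub> k x)"
      using \<open>x \<in> carrier S\<close> by (simp add: h_mult h_k k_closed)
    then show "a \<otimes>\<^bsub>S\<^esub> x \<in> h ` I"
      using \<open>b \<in> I\<close> \<open>x \<in> carrier S\<close> by (simp add: right_closed k_closed)
  qed
qed

lemma ideal_image:
  assumes "ideal I R"
  shows "ideal (h ` I) S"
proof -
  interpret ideal I R by fact
  have "left_ideal I R" "right_ideal I R"
    by unfold_locales (simp_all add: I_l_closed I_r_closed)
  then have "left_ideal (h ` I) S" "right_ideal (h ` I) S"
    using left_ideal_image right_ideal_image by auto
  then show ?thesis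
    by (auto simp: ideal_def left_ideal_def right_ideal_def ideal_axioms_def
        left_ideal_axioms_def right_ideal_axioms_def)
qed

lemma left_span_image:
  assumes "left_ideal I R" "A \<subseteq> carrier R" "I = left_span R A"
  shows "h ` I = left_span S (h ` A)"
proof
  interpret inv: ring_isomorphism S R k h by (rule inverse_isomorphism)
  have "A \<subseteq> I" unfolding assms(3) left_span_def by blast
  then show "left_span S (h ` A) \<subseteq> h ` I"
    unfolding left_span_def using left_ideal_image[OF assms(1)] by blast
  show "h ` I \<subseteq> left_span S (h ` A)"
    unfolding left_span_def
  proof (rule Inter_greatest)
    fix K assume "K \<in> {K. left_ideal K S \<and> h ` A \<subseteq> K}"
    then have K: "left_ideal K S" "h ` A \<subseteq> K" by auto
    then interpret left_ideal K S by simp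
    have "A \<subseteq> k ` K" using K(2) k_image_h_image[OF assms(2)] by blast
    then have "I \<subseteq> k ` K"
      unfolding assms(3) left_span_def using inv.left_ideal_image[OF K(1)] by blast
    then show "h ` I \<subseteq> K" using inv.k_image_h_image[OF a_subset] by blast
  qed
qed

lemma right_span_image:
  assumes "right_ideal I R" "A \<subseteq> carrier R" "I = right_span R A"
  shows "h ` I = right_span S (h ` A)"
proof
  interpret inv: ring_isomorphism S R k h by (rule inverse_isomorphism)
  have "A \<subseteq> I" unfolding assms(3) right_span_def by blast
  then show "right_span S (h ` A) \<subseteq> h ` I"
    unfolding right_span_def using right_ideal_image[OF assms(1)] by blast
  show "h ` I \<subseteq> right_span S (h ` A)"
    unfolding right_span_def
  proof (rule Inter_greatest)
    fix K assume "K \<in> {K. right_ideal K S \<and> h ` A \<subseteq> K}"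
    then have K: "right_ideal K S" "h ` A \<subseteq> K" by auto
    then interpret right_ideal K S by simp
    have "A \<subseteq> k ` K" using K(2) k_image_h_image[OF assms(2)] by blast
    then have "I \<subseteq> k ` K"
      unfolding assms(3) right_span_def using inv.right_ideal_image[OF K(1)] by blast
    then show "h ` I \<subseteq> K" using inv.k_image_h_image[OF a_subset] by blast
  qed
qed

lemma lr_noetherian_image:
  assumes "lr_noetherian_ring R"
  shows "lr_noetherian_ring S"
proof -
  interpret noeth: lr_noetherian_ring R by fact
  interpret inv: ring_isomorphism S R k h by (rule inverse_isomorphism)
  show ?thesis
  proof
    fix I assume I: "left_ideal I S"
    then interpret left_ideal I S .
    obtain A where A: "A \<subseteq> carrier R" "finite A" "k ` I = left_span R A"
      using noeth.left_fin_gen[OF inv.left_ideal_image[OF I]] by blast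
    then have "I = left_span S (h ` A)"
      using left_span_image[OF inv.left_ideal_image[OF I]] inv.k_image_h_image[OF a_subset] by simp
    then show "\<exists>A\<subseteq>carrier S. finite A \<and> I = left_span S A"
      using A h_closed by (intro exI[of _ "h ` A"]) auto
  next
    fix I assume I: "right_ideal I S"
    then interpret right_ideal I S .
    obtain A where A: "A \<subseteq> carrier R" "finite A" "k ` I = right_span R A"
      using noeth.right_fin_gen[OF inv.right_ideal_image[OF I]] by blast
    then have "I = right_span S (h ` A)"
      using right_span_image[OF inv.right_ideal_image[OF I]] inv.k_image_h_image[OF a_subset] by simp
    then show "\<exists>A\<subseteq>carrier S. finite A \<and> I = right_span S A"
      using A h_closed by (intro exI[of _ "h ` A"]) auto
  qed
qed

lemma ideal_subset: "ideal I R \<Longrightarrow> I \<subseteq> carrier R"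
  by (simp add: additive_subgroup.a_subset ideal.axioms(1))

lemma nc_prime_ideal_image:
  assumes "nc_prime_ideal P R"
  shows "nc_prime_ideal (h ` P) S"
proof -
  interpret P: nc_prime_ideal P R by fact
  interpret inv: ring_isomorphism S R k h by (rule inverse_isomorphism)
  note sub = ideal_subset[OF P.is_ideal]
  interpret img: ideal "h ` P" S using ideal_image P.is_ideal by blast
  show ?thesis
  proof
    show "h ` P \<noteq> carrier S"
      using k_image_h_image[OF sub] inv.h_image_carrier P.proper by metis
    fix I J assume IJ: "ideal I S" "ideal J S" "I \<cdot>\<^bsub>S\<^esub> J \<subseteq> h ` P"
    have subs: "I \<subseteq> carrier S" "J \<subseteq> carrier S" using IJ inv.ideal_subset by auto
    have mem: "x \<in> carrier R \<and> h x \<in> I \<cdot>\<^bsub>S\<^esub> J" if "x \<in> k ` I \<cdot>\<^bsub>R\<^esub> k ` J" for x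
      using that
    proof induction
      case (prod i j)
      then obtain i' j' where "i' \<in> I" "i = k i'" "j' \<in> J" "j = k j'" by blast
      moreover from this have "i' \<in> carrier S" "j' \<in> carrier S" using subs by auto
      ultimately show ?case by (simp add: h_mult h_k k_closed ideal_prod.prod)
    next
      case (sum a b)
      then show ?case by (simp add: h_add ideal_prod.sum)
    qed
    have "k ` I \<cdot>\<^bsub>R\<^esub> k ` J \<subseteq> P"
    proof
      fix x assume "x \<in> k ` I \<cdot>\<^bsub>R\<^esub> k ` J"
      then have x: "x \<in> carrier R" "h x \<in> h ` P" using mem IJ(3) by auto
      then obtain y where "y \<in> P" "h x = h y" by blast
      moreover have "k (h x) = x" "k (h y) = y" using k_h x(1) \<open>y \<in> P\<close> sub by blast+
      ultimately have "x = y" by metis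
      then show "x \<in> P" using \<open>y \<in> P\<close> by simp
    qed
    then have "k ` I \<subseteq> P \<or> k ` J \<subseteq> P"
      using P.prime[OF inv.ideal_image[OF IJ(1)] inv.ideal_image[OF IJ(2)]] by simp
    then have "h ` k ` I \<subseteq> h ` P \<or> h ` k ` J \<subseteq> h ` P"
      by (metis image_mono)
    then show "I \<subseteq> h ` P \<or> J \<subseteq> h ` P"
      unfolding inv.k_image_h_image[OF subs(1)] inv.k_image_h_image[OF subs(2)] .
  qed
qed

lemma normal_principal_image:
  assumes "normal_principal R I"
  shows "normal_principal S (h ` I)"
proof -
  interpret inv: ring_isomorphism S R k h by (rule inverse_isomorphism)
  obtain a where a: "a \<in> carrier R" "carrier R #>\<^bsub>R\<^esub> a = a <#\<^bsub>R\<^esub> carrier R" "I = Idl\<^bsub>R\<^esub> {a}"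
    using assms by (auto simp: normal_principal_def normal_element_def)
  have "h ` (carrier R #>\<^bsub>R\<^esub> a) = carrier S #>\<^bsub>S\<^esub> h a"
    using a(1) by (auto simp: r_coset_def h_mult h_image_carrier[symmetric] image_UN)
  moreover have "h ` (a <#\<^bsub>R\<^esub> carrier R) = h a <#\<^bsub>S\<^esub> carrier S"
    using a(1) by (auto simp: l_coset_def h_mult h_image_carrier[symmetric] image_UN)
  ultimately have "normal_element S (h a)"
    using a h_closed by (simp add: normal_element_def)
  moreover have "h ` I = Idl\<^bsub>S\<^esub> {h a}"
  proof
    have I: "ideal I R" "a \<in> I"
      unfolding a(3) using a(1) R.genideal_ideal[of "{a}"] R.genideal_self'[of a] by auto
    show "Idl\<^bsub>S\<^esub> {h a} \<subseteq> h ` I"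
      using I by (intro S.genideal_minimal ideal_image) auto
    have J: "ideal (Idl\<^bsub>S\<^esub> {h a}) S" "h a \<in> Idl\<^bsub>S\<^esub> {h a}"
      using a(1) h_closed S.genideal_ideal[of "{h a}"] S.genideal_self'[of "h a"] by auto
    have "a \<in> k ` (Idl\<^bsub>S\<^esub> {h a})" using J(2) k_h[OF a(1)] by force
    then have "I \<subseteq> k ` (Idl\<^bsub>S\<^esub> {h a})"
      unfolding a(3) using inv.ideal_image[OF J(1)] by (intro R.genideal_minimal) auto
    then show "h ` I \<subseteq> Idl\<^bsub>S\<^esub> {h a}"
      using inv.k_image_h_image[OF inv.ideal_subset[OF J(1)]] by blast
  qed
  ultimately show ?thesis unfolding normal_principal_def by blast
qed

theorem noetherian_UFR_image:
  assumes "noetherian_UFR R"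
  shows "noetherian_UFR S"
  unfolding noetherian_UFR_def
proof (intro conjI allI impI)
  interpret inv: ring_isomorphism S R k h by (rule inverse_isomorphism)
  show "lr_noetherian_ring S" using assms lr_noetherian_image by (simp add: noetherian_UFR_def)
  have "nc_prime_ideal {\<zero>\<^bsub>R\<^esub>} R" using assms by (simp add: noetherian_UFR_def nc_prime_ring_def)
  then have "nc_prime_ideal {\<zero>\<^bsub>S\<^esub>} S" using nc_prime_ideal_image[of "{\<zero>\<^bsub>R\<^esub>}"] h_zero by simp
  then show "nc_prime_ring S" using S.ring_axioms by (simp add: nc_prime_ring_def)
  fix P assume P: "nc_prime_ideal P S \<and> P \<noteq> {\<zero>\<^bsub>S\<^esub>}"
  then have sub: "P \<subseteq> carrier S" using inv.ideal_subset nc_prime_ideal.axioms(1) by blast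
  have "k ` P \<noteq> {\<zero>\<^bsub>R\<^esub>}" using inv.k_image_h_image[OF sub] P h_zero by force
  then obtain Q where Q: "nc_prime_ideal Q R" "normal_principal R Q" "Q \<noteq> {\<zero>\<^bsub>R\<^esub>}" "Q \<subseteq> k ` P"
    using assms P inv.nc_prime_ideal_image unfolding noetherian_UFR_def by blast
  have "Q \<subseteq> carrier R" using Q(1) ideal_subset nc_prime_ideal.axioms(1) by blast
  then have "h ` Q \<noteq> {\<zero>\<^bsub>S\<^esub>}" using k_image_h_image[of Q] Q(3) inv.h_zero by force
  moreover have "h ` Q \<subseteq> P" using Q(4) inv.k_image_h_image[OF sub] by blast
  ultimately show "\<exists>Q. nc_prime_ideal Q S \<and> normal_principal S Q \<and> Q \<noteq> {\<zero>\<^bsub>S\<^esub>} \<and> Q \<subseteq> P"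
    using nc_prime_ideal_image[OF Q(1)] normal_principal_image[OF Q(2)] by blast
qed

end

lemma noetherian_UFR_iso:
  assumes "ring R" "ring S" "h \<in> ring_iso R S" "noetherian_UFR S"
  shows "noetherian_UFR R"
proof -
  let ?k = "inv_into (carrier R) h"
  have bij: "bij_betw h (carrier R) (carrier S)" using assms(3) by (rule ring_iso_memE)
  have "ring_isomorphism S R ?k h"
  proof (intro ring_isomorphism.intro ring_isomorphism_axioms.intro)
    show "?k \<in> ring_hom S R" "h \<in> ring_hom R S"
      using ring_iso_set_sym[OF assms(1,3)] assms(3) by (auto simp: ring_iso_def)
    show "h (?k x) = x" if "x \<in> carrier S" for x using bij that by (rule bij_betw_inv_into_right)
    show "?k (h x) = x" if "x \<in> carrier R" for x using bij that by (rule bij_betw_inv_into_left)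
  qed (fact assms)+
  then show ?thesis using ring_isomorphism.noetherian_UFR_image assms(4) by blast
qed

section \<open>The free algebra\<close>

lemma free_algebra_simps [simp]:
  "carrier (free_algebra X) = {f. finite {w. f w \<noteq> 0} \<and> {w. f w \<noteq> 0} \<subseteq> lists X}"
  "(f \<otimes>\<^bsub>free_algebra X\<^esub> g) = (\<lambda>w. \<Sum>i\<le>length w. f (take i w) * g (drop i w))"
  "\<one>\<^bsub>free_algebra X\<^esub> = (\<lambda>w. if w = [] then 1 else 0)"
  "\<zero>\<^bsub>free_algebra X\<^esub> = (\<lambda>w. 0)"
  "f \<oplus>\<^bsub>free_algebra X\<^esub> g = (\<lambda>w. f w + g w)"
  by (simp_all add: free_algebra_def)

text \<open>
  Cutting a word in two is easier to reindex as a set of pairs than as a range of positions.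
\<close>
definition splits :: "'x list \<Rightarrow> ('x list \<times> 'x list) set"
  where "splits w = {(u, v). u @ v = w}"

lemma bij_betw_splits: "bij_betw (\<lambda>i. (take i w, drop i w)) {..length w} (splits w)"
proof (rule bij_betw_byWitness[where f' = "\<lambda>(u, v). length u"])
  show "(\<lambda>(u, v). length u) ` splits w \<subseteq> {..length w}" by (auto simp: splits_def)
qed (auto simp: splits_def)

lemma finite_splits: "finite (splits w)"
  using bij_betw_finite[OF bij_betw_splits] by simp

lemma free_mult_splits:
  "(f \<otimes>\<^bsub>free_algebra X\<^esub> g) w = (\<Sum>(u, v)\<in>splits w. f u * g v)"
  using sum.reindex_bij_betw[OF bij_betw_splits, of "\<lambda>(u, v). f u * g v" w] by simp

text \<open>
  Both sides sum over all ways of cutting a word in three.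
\<close>
lemma free_mult_assoc:
  "f \<otimes>\<^bsub>free_algebra X\<^esub> g \<otimes>\<^bsub>free_algebra X\<^esub> h = f \<otimes>\<^bsub>free_algebra X\<^esub> (g \<otimes>\<^bsub>free_algebra X\<^esub> h)"
proof
  fix w
  have "(f \<otimes>\<^bsub>free_algebra X\<^esub> g \<otimes>\<^bsub>free_algebra X\<^esub> h) w =
      (\<Sum>(x, z)\<in>splits w. \<Sum>(u, v)\<in>splits x. f u * g v * h z)"
    by (simp only: free_mult_splits sum_distrib_right case_prod_unfold)
  also have "\<dots> = (\<Sum>((x, z), (u, v))\<in>Sigma (splits w) (\<lambda>(x, z). splits x). f u * g v * h z)"
    by (simp add: sum.Sigma finite_splits case_prod_unfold)
  also have "\<dots> = (\<Sum>((u, y), (v, z))\<in>Sigma (splits w) (\<lambda>(u, y). splits y). f u * g v * h z)"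
    by (rule sum.reindex_bij_witness[where i = "\<lambda>((u, y), (v, z)). ((u @ v, z), (u, v))"
          and j = "\<lambda>((x, z), (u, v)). ((u, v @ z), (v, z))"]) (auto simp: splits_def)
  also have "\<dots> = (\<Sum>(u, y)\<in>splits w. \<Sum>(v, z)\<in>splits y. f u * (g v * h z))"
    by (simp add: sum.Sigma finite_splits case_prod_unfold mult.assoc)
  also have "\<dots> = (f \<otimes>\<^bsub>free_algebra X\<^esub> (g \<otimes>\<^bsub>free_algebra X\<^esub> h)) w"
    by (simp only: free_mult_splits sum_distrib_left case_prod_unfold)
  finally show "(f \<otimes>\<^bsub>free_algebra X\<^esub> g \<otimes>\<^bsub>free_algebra X\<^esub> h) w = (f \<otimes>\<^bsub>free_algebra X\<^esub> (g \<otimes>\<^bsub>free_algebra X\<^esub> h)) w" .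
qed

lemma free_mult_closed:
  assumes "f \<in> carrier (free_algebra X)" "g \<in> carrier (free_algebra X)"
  shows "f \<otimes>\<^bsub>free_algebra X\<^esub> g \<in> carrier (free_algebra X)"
proof -
  let ?S = "(\<lambda>(u, v). u @ v) ` ({w. f w \<noteq> 0} \<times> {w. g w \<noteq> 0})"
  have sub: "{w. (f \<otimes>\<^bsub>free_algebra X\<^esub> g) w \<noteq> 0} \<subseteq> ?S"
  proof
    fix w assume "w \<in> {w. (f \<otimes>\<^bsub>free_algebra X\<^esub> g) w \<noteq> 0}"
    then have "(\<Sum>(u, v)\<in>splits w. f u * g v) \<noteq> 0" by (simp only: free_mult_splits mem_Collect_eq) simp
    then obtain uv where "uv \<in> splits w" "(case uv of (u, v) \<Rightarrow> f u * g v) \<noteq> 0"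
      by (rule sum.not_neutral_contains_not_neutral)
    then show "w \<in> ?S" by (auto simp: splits_def)
  qed
  moreover have "finite ?S" using assms by simp
  moreover have "?S \<subseteq> lists X"
  proof -
    have "u \<in> lists X" "v \<in> lists X" if "f u \<noteq> 0" "g v \<noteq> 0" for u v using assms that by auto
    then show ?thesis by fastforce
  qed
  ultimately have "finite {w. (f \<otimes>\<^bsub>free_algebra X\<^esub> g) w \<noteq> 0}" "{w. (f \<otimes>\<^bsub>free_algebra X\<^esub> g) w \<noteq> 0} \<subseteq> lists X"
    using finite_subset by blast+
  then show ?thesis unfolding free_algebra_simps(1) by blast
qed

lemma free_one_mult:
  fixes f :: "'x list \<Rightarrow> 'k::field"
  shows "\<one>\<^bsub>free_algebra X\<^esub> \<otimes>\<^bsub>free_algebra X\<^esub> f = f"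
proof
  fix w
  have "(\<one>\<^bsub>free_algebra X\<^esub> \<otimes>\<^bsub>free_algebra X\<^esub> f) w = (\<Sum>(u, v)\<in>{([] :: 'x list, w)}. (if u = [] then 1 else 0) * f v)"
    unfolding free_mult_splits free_algebra_simps(3)
    by (rule sum.mono_neutral_right[OF finite_splits]) (auto simp: splits_def split: if_splits)
  then show "(\<one>\<^bsub>free_algebra X\<^esub> \<otimes>\<^bsub>free_algebra X\<^esub> f) w = f w" by simp
qed

lemma free_mult_one:
  fixes f :: "'x list \<Rightarrow> 'k::field"
  shows "f \<otimes>\<^bsub>free_algebra X\<^esub> \<one>\<^bsub>free_algebra X\<^esub> = f"
proof
  fix w
  have "(f \<otimes>\<^bsub>free_algebra X\<^esub> \<one>\<^bsub>free_algebra X\<^esub>) w = (\<Sum>(u, v)\<in>{(w, [] :: 'x list)}. f u * (if v = [] then 1 else 0))"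
    unfolding free_mult_splits free_algebra_simps(3)
    by (rule sum.mono_neutral_right[OF finite_splits]) (auto simp: splits_def split: if_splits)
  then show "(f \<otimes>\<^bsub>free_algebra X\<^esub> \<one>\<^bsub>free_algebra X\<^esub>) w = f w" by simp
qed

lemma ring_free_algebra: "ring (free_algebra X)"
proof (rule ringI)
  have fin: "finite {w. f w + g w \<noteq> 0}" "{w. f w + g w \<noteq> 0} \<subseteq> lists X"
    if "finite {w. f w \<noteq> 0}" "finite {w. g w \<noteq> 0}" "{w. f w \<noteq> 0} \<subseteq> lists X" "{w. g w \<noteq> 0} \<subseteq> lists X"
    for f g :: "'a list \<Rightarrow> 'b"
  proof -
    have "{w. f w + g w \<noteq> 0} \<subseteq> {w. f w \<noteq> 0} \<union> {w. g w \<noteq> 0}" by auto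
    then show "finite {w. f w + g w \<noteq> 0}" "{w. f w + g w \<noteq> 0} \<subseteq> lists X"
      using that finite_subset[of _ "{w. f w \<noteq> 0} \<union> {w. g w \<noteq> 0}"] by auto
  qed
  show "abelian_group (free_algebra X :: ('a list \<Rightarrow> 'b) ring)"
  proof (rule abelian_groupI)
    fix f :: "'a list \<Rightarrow> 'b" assume "f \<in> carrier (free_algebra X)"
    then show "\<exists>g\<in>carrier (free_algebra X). g \<oplus>\<^bsub>free_algebra X\<^esub> f = \<zero>\<^bsub>free_algebra X\<^esub>"
      by (intro bexI[of _ "\<lambda>w. - f w"]) simp_all
  qed (use fin in \<open>simp_all add: add_ac\<close>)
  show "Group.monoid (free_algebra X :: ('a list \<Rightarrow> 'b) ring)"
  proof (rule monoidI)
    have "{w. (if w = ([] :: 'a list) then 1 else 0 :: 'b) \<noteq> 0} = {[]}" by auto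
    then show "\<one>\<^bsub>free_algebra X\<^esub> \<in> carrier (free_algebra X :: ('a list \<Rightarrow> 'b) ring)" by simp
  qed (rule free_mult_closed free_mult_assoc free_one_mult free_mult_one; assumption)+
qed (simp_all add: algebra_simps sum.distrib)

definition word :: "'k \<Rightarrow> 'x list \<Rightarrow> 'x list \<Rightarrow> 'k::field"
  where "word c u = (\<lambda>w. if w = u then c else 0)"

lemma word_closed: "u \<in> lists X \<Longrightarrow> word c u \<in> carrier (free_algebra X)"
  by (auto simp: word_def)

lemma word_mult: "word c u \<otimes>\<^bsub>free_algebra X\<^esub> word d v = word (c * d) (u @ v)"
proof
  fix w
  have "(word c u \<otimes>\<^bsub>free_algebra X\<^esub> word d v) w = (\<Sum>(u', v')\<in>splits w. if (u', v') = (u, v) then c * d else 0)"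
    unfolding free_mult_splits by (rule sum.cong) (auto simp: word_def split: if_splits)
  also have "\<dots> = (\<Sum>x\<in>splits w. if x = (u, v) then c * d else 0)"
    by (simp add: case_prod_unfold prod_eq_iff)
  also have "\<dots> = word (c * d) (u @ v) w"
    by (subst sum.delta[OF finite_splits]) (auto simp: word_def splits_def)
  finally show "(word c u \<otimes>\<^bsub>free_algebra X\<^esub> word d v) w = word (c * d) (u @ v) w" .
qed

lemma free_minus:
  assumes "f \<in> carrier (free_algebra X)" "g \<in> carrier (free_algebra X)"
  shows "f \<ominus>\<^bsub>free_algebra X\<^esub> g = (\<lambda>w. f w - g w)"
proof -
  interpret ring "free_algebra X" by (rule ring_free_algebra)
  have "\<ominus>\<^bsub>free_algebra X\<^esub> g = (\<lambda>w. - g w)"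
    using assms by (intro minus_equality) simp_all
  then show ?thesis by (simp add: a_minus_def)
qed

section \<open>Evaluating words\<close>

fun exponent :: "nat list \<Rightarrow> (nat \<Rightarrow>\<^sub>0 nat)"
  where "exponent [] = 0" | "exponent (i # w) = single i 1 + exponent w"

lemma lookup_exponent: "lookup (exponent w) i = count (mset w) i"
  by (induction w) (auto simp: lookup_add lookup_single when_def)

lemma keys_exponent: "keys (exponent w) = set w"
  by (auto simp: in_keys_iff lookup_exponent)

lemma exponent_inj_sorted:
  assumes "sorted u" "sorted v" "exponent u = exponent v"
  shows "u = v"
proof -
  have "mset u = mset v"
    by (rule multiset_eqI) (simp flip: lookup_exponent add: assms(3))
  then show ?thesis using assms(1,2) by (metis properties_for_sort)
qed

lemma exponent_surj: "\<exists>w. exponent w = a"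
proof (induction "exponent_degree a" arbitrary: a rule: less_induct)
  case less
  show ?case
  proof (cases "a = 0")
    case True
    then show ?thesis by (intro exI[of _ "[]"]) simp
  next
    case False
    then obtain v where v: "v \<in> keys a" using ex_key by blast
    define b where "b = a - single v 1"
    have b: "a = single v 1 + b"
      using v by (intro poly_mapping_eqI) (auto simp: b_def lookup_add lookup_minus lookup_single when_def in_keys_iff)
    have "exponent_degree (single v 1 :: nat \<Rightarrow>\<^sub>0 nat) = 1" by (simp add: exponent_degree_def)
    then have "exponent_degree b < exponent_degree a" unfolding b exponent_degree_add by linarith
    then obtain w where "exponent w = b" using less.hyps by blast
    then show ?thesis using b by (intro exI[of _ "v # w"]) simp
  qed
qed

context quantum_space
begin

fun monomial :: "nat list \<Rightarrow> (nat \<Rightarrow>\<^sub>0 nat) \<Rightarrow>\<^sub>0 'k"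
  where "monomial [] = 1" | "monomial (i # w) = var i \<star> monomial w"

lemma monomial_append: "monomial (u @ v) = monomial u \<star> monomial v"
  by (induction u) (simp_all add: tmul_assoc)

lemma monomial_eq: "\<exists>c. c \<noteq> 0 \<and> monomial w = single (exponent w) c"
proof (induction w)
  case Nil
  then show ?case by (intro exI[of _ 1]) simp
next
  case (Cons i w)
  then obtain c where "c \<noteq> 0" "monomial w = single (exponent w) c" by blast
  then show ?case
    by (intro exI[of _ "q (single i 1) (exponent w) * c"]) (simp add: tmul_single_single)
qed

lemma monomial_polys: "w \<in> lists V \<Longrightarrow> monomial w \<in> polys V"
  by (induction w) (auto intro!: polys_tmul var_in_polys simp del: One_nat_def)

definition eval_words :: "(nat list \<Rightarrow> 'k) \<Rightarrow> (nat \<Rightarrow>\<^sub>0 nat) \<Rightarrow>\<^sub>0 'k"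
  where "eval_words f = (\<Sum>w | f w \<noteq> 0. single 0 (f w) \<star> monomial w)"

lemma eval_words_superset:
  assumes "finite A" "{w. f w \<noteq> 0} \<subseteq> A"
  shows "eval_words f = (\<Sum>w\<in>A. single 0 (f w) \<star> monomial w)"
  unfolding eval_words_def using assms by (intro sum.mono_neutral_left) auto

lemma eval_word: "eval_words (word c w) = single 0 c \<star> monomial w"
proof -
  have "{u. word c w u \<noteq> 0} \<subseteq> {w}" by (auto simp: word_def)
  then show ?thesis using eval_words_superset[of "{w}" "word c w"] by (simp add: word_def)
qed

lemma eval_words_add:
  assumes "f \<in> carrier (free_algebra X)" "g \<in> carrier (free_algebra X)"
  shows "eval_words (\<lambda>w. f w + g w) = eval_words f + eval_words g"
proof -
  let ?A = "{w. f w \<noteq> 0} \<union> {w. g w \<noteq> 0}"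
  have "finite ?A" using assms by simp
  then have "eval_words e = (\<Sum>w\<in>?A. single 0 (e w) \<star> monomial w)" if "{w. e w \<noteq> 0} \<subseteq> ?A" for e
    using that by (rule eval_words_superset)
  moreover have "{w. f w + g w \<noteq> 0} \<subseteq> ?A" by auto
  ultimately show ?thesis
    by (simp add: single_add tmul_distrib_right sum.distrib)
qed

lemma eval_words_mult:
  assumes f: "f \<in> carrier (free_algebra X)" and g: "g \<in> carrier (free_algebra X)"
  shows "eval_words (f \<otimes>\<^bsub>free_algebra X\<^esub> g) = eval_words f \<star> eval_words g"
proof -
  let ?A = "{w. f w \<noteq> 0}" and ?B = "{w. g w \<noteq> 0}" and ?h = "f \<otimes>\<^bsub>free_algebra X\<^esub> g"
  let ?C = "(\<lambda>(u, v). u @ v) ` (?A \<times> ?B)"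
  let ?t = "\<lambda>u v. single 0 (f u * g v) \<star> monomial (u @ v)"
  have fin: "finite ?A" "finite ?B" using f g by simp_all
  have h: "?h w = (\<Sum>(u, v)\<in>{x \<in> ?A \<times> ?B. (case x of (u, v) \<Rightarrow> u @ v) = w}. f u * g v)" for w
    unfolding free_mult_splits
    by (rule sum.mono_neutral_right[OF finite_splits]) (auto simp: splits_def)
  have sub: "{w. ?h w \<noteq> 0} \<subseteq> ?C"
  proof
    fix w assume "w \<in> {w. ?h w \<noteq> 0}"
    then have "(\<Sum>(u, v)\<in>{x \<in> ?A \<times> ?B. (case x of (u, v) \<Rightarrow> u @ v) = w}. f u * g v) \<noteq> 0"
      by (simp only: h mem_Collect_eq) simp
    then obtain x where "x \<in> {x \<in> ?A \<times> ?B. (case x of (u, v) \<Rightarrow> u @ v) = w}"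
      by (metis (no_types, lifting) sum.empty ex_in_conv)
    then show "w \<in> ?C" by force
  qed
  have "eval_words ?h = (\<Sum>w\<in>?C. single 0 (?h w) \<star> monomial w)"
    using fin sub by (intro eval_words_superset) auto
  also have "\<dots> = (\<Sum>w\<in>?C. \<Sum>(u, v)\<in>{x \<in> ?A \<times> ?B. (case x of (u, v) \<Rightarrow> u @ v) = w}. ?t u v)"
  proof (rule sum.cong[OF refl])
    fix w
    have single_sum: "single 0 (sum e A) = (\<Sum>x\<in>A. single 0 (e x :: 'k))" for e and A :: "(nat list \<times> nat list) set"
      by (induction A rule: infinite_finite_induct) (simp_all add: single_add)
    show "single 0 (?h w) \<star> monomial w =
        (\<Sum>(u, v)\<in>{x \<in> ?A \<times> ?B. (case x of (u, v) \<Rightarrow> u @ v) = w}. ?t u v)"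
      unfolding h single_sum tmul_sum_left by (rule sum.cong) auto
  qed
  also have "\<dots> = (\<Sum>(u, v)\<in>?A \<times> ?B. ?t u v)"
    using fin by (intro sum.group) auto
  also have "\<dots> = (\<Sum>u\<in>?A. \<Sum>v\<in>?B. (single 0 (f u) \<star> monomial u) \<star> (single 0 (g v) \<star> monomial v))"
  proof -
    have "?t u v = (single 0 (f u) \<star> monomial u) \<star> (single 0 (g v) \<star> monomial v)" for u v
    proof -
      have "(single 0 (f u) \<star> monomial u) \<star> (single 0 (g v) \<star> monomial v) =
          single 0 (f u) \<star> (monomial u \<star> single 0 (g v)) \<star> monomial v"
        by (simp only: tmul_assoc)
      also have "\<dots> = single 0 (f u) \<star> (single 0 (g v) \<star> (monomial u \<star> monomial v))"
        by (simp only: scalar_commute tmul_assoc)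
      finally show ?thesis by (simp add: monomial_append scalar_scalar)
    qed
    then show ?thesis by (simp add: sum.cartesian_product)
  qed
  also have "\<dots> = eval_words f \<star> eval_words g"
    unfolding eval_words_def tmul_sum_left tmul_sum_right by (rule sum.swap)
  finally show ?thesis .
qed

lemma eval_words_polys: "f \<in> carrier (free_algebra V) \<Longrightarrow> eval_words f \<in> polys V"
proof -
  assume f: "f \<in> carrier (free_algebra V)"
  have sum: "(\<Sum>x\<in>A. e x) \<in> polys V" if "\<And>x. x \<in> A \<Longrightarrow> e x \<in> polys V" for e and A :: "nat list set"
    using that by (induction A rule: infinite_finite_induct) (auto intro: polys_add)
  show ?thesis unfolding eval_words_def
    using f by (intro sum polys_tmul monomial_polys) auto
qed

lemma eval_words_hom: "eval_words \<in> ring_hom (free_algebra V) (qring V)"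
proof (rule ring_hom_memI)
  have one: "\<one>\<^bsub>free_algebra V\<^esub> = word 1 []" by (simp add: word_def)
  show "eval_words \<one>\<^bsub>free_algebra V\<^esub> = \<one>\<^bsub>qring V\<^esub>" unfolding one eval_word by simp
  show "eval_words (f \<oplus>\<^bsub>free_algebra V\<^esub> g) = eval_words f \<oplus>\<^bsub>qring V\<^esub> eval_words g"
    if "f \<in> carrier (free_algebra V)" "g \<in> carrier (free_algebra V)" for f g
    unfolding free_algebra_simps(5) qring_simps using that by (rule eval_words_add)
  show "eval_words (f \<otimes>\<^bsub>free_algebra V\<^esub> g) = eval_words f \<otimes>\<^bsub>qring V\<^esub> eval_words g"
    if "f \<in> carrier (free_algebra V)" "g \<in> carrier (free_algebra V)" for f g
    unfolding qring_simps using that by (rule eval_words_mult)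
  show "eval_words f \<in> carrier (qring V)" if "f \<in> carrier (free_algebra V)" for f
    unfolding qring_simps using that by (rule eval_words_polys)
qed

lemma eval_words_surj: "eval_words ` carrier (free_algebra V) = carrier (qring V)"
proof
  show "eval_words ` carrier (free_algebra V) \<subseteq> carrier (qring V)"
    using ring_hom_closed[OF eval_words_hom] by blast
  interpret F: ring "free_algebra V" by (rule ring_free_algebra)
  let ?I = "eval_words ` carrier (free_algebra V)"
  have add: "f + g \<in> ?I" if "f \<in> ?I" "g \<in> ?I" for f g
    using that ring_hom_add[OF eval_words_hom] F.a_closed by (smt (verit) image_iff qring_simps(5))
  have zero: "0 \<in> ?I"
    using ring_hom_zero[OF eval_words_hom ring_free_algebra ring_qring] F.zero_closed by (metis image_eqI qring_simps(4))
  have single: "single a c \<in> ?I" if "keys a \<subseteq> V" for a c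
  proof -
    obtain w where w: "exponent w = a" using exponent_surj by blast
    then have "w \<in> lists V" using that keys_exponent[of w] by auto
    obtain d where d: "d \<noteq> 0" "monomial w = single a d" using monomial_eq[of w] w by blast
    have "eval_words (word (c / d) w) = single a c"
      using d by (simp add: eval_word tmul_single_single)
    then show ?thesis using word_closed[OF \<open>w \<in> lists V\<close>] by (metis image_eqI)
  qed
  have sum: "(\<Sum>a\<in>A. single a (e a)) \<in> ?I" if "\<And>a. a \<in> A \<Longrightarrow> keys a \<subseteq> V" for A e
    using that
  proof (induction A rule: infinite_finite_induct)
    case (insert a A)
    then show ?case using add[OF single[of a "e a"], of "\<Sum>a\<in>A. single a (e a)"] by simp
  qed (use zero in simp_all)
  show "carrier (qring V) \<subseteq> ?I"
  proof
    fix f assume "f \<in> carrier (qring V)"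
    then have "(\<Sum>a\<in>keys f. single a (lookup f a)) \<in> ?I"
      by (intro sum) (simp add: polys_def)
    then show "f \<in> ?I" by (simp only: single_sum_keys[symmetric])
  qed
qed

text \<open>
  Different sorted words are sent to multiples of different monomials, so the images of the sorted
  words are linearly independent.
\<close>
lemma eval_words_kernel_sorted:
  assumes g: "finite {w. g w \<noteq> 0}" "\<And>w. g w \<noteq> 0 \<Longrightarrow> sorted w" and 0: "eval_words g = 0"
  shows "g w = 0"
proof (rule ccontr)
  assume w: "g w \<noteq> 0"
  obtain c where c: "c \<noteq> 0" "monomial w = single (exponent w) c" using monomial_eq by blast
  have "lookup (eval_words g) (exponent w) = (\<Sum>u | g u \<noteq> 0. if u = w then g w * c else 0)"
    unfolding eval_words_def lookup_sum
  proof (rule sum.cong[OF refl])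
    fix u assume "u \<in> {u. g u \<noteq> 0}"
    then have "sorted u" "sorted w" using g(2) w by auto
    show "lookup (single 0 (g u) \<star> monomial u) (exponent w) = (if u = w then g w * c else 0)"
    proof (cases "u = w")
      case True
      then show ?thesis using c(2) by simp
    next
      case False
      then have "exponent u \<noteq> exponent w"
        using exponent_inj_sorted[OF \<open>sorted u\<close> \<open>sorted w\<close>] by blast
      moreover obtain d where "monomial u = single (exponent u) d" using monomial_eq by blast
      ultimately show ?thesis using False by (simp add: lookup_single when_def)
    qed
  qed
  also have "\<dots> = g w * c" using w g(1) by (simp add: sum.delta)
  finally show False using 0 w c by simp
qed

end

section \<open>The presentation by generators and relations\<close>

(* From here on carriers and the index set {1..n} stay folded. *)
declare free_algebra_simps [simp del] One_nat_def [simp del]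

locale skew_parameters =
  fixes n :: nat and p :: "nat \<Rightarrow> nat \<Rightarrow> 'k::field"
  assumes p_nonzero: "\<And>i j. \<lbrakk>i \<in> {1..n}; j \<in> {1..n}\<rbrakk> \<Longrightarrow> p i j \<noteq> 0"
    and p_inverse: "\<And>i j. \<lbrakk>i \<in> {1..n}; j \<in> {1..n}\<rbrakk> \<Longrightarrow> p i j * p j i = 1"
    and p_diag: "\<And>i. i \<in> {1..n} \<Longrightarrow> p i i = 1"
begin

text \<open>
  The scalar that arises when the product of the ordered monomials \<open>x\<^sup>a\<close> and
  \<open>x\<^sup>b\<close> is sorted: each \<open>x\<^sub>i\<close> of the first factor has to be
  moved past every \<open>x\<^sub>j\<close> of the second one with \<open>j < i\<close>.
\<close>
definition bichar :: "(nat \<Rightarrow>\<^sub>0 nat) \<Rightarrow> (nat \<Rightarrow>\<^sub>0 nat) \<Rightarrow> 'k"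
  where "bichar a b = (\<Prod>i\<in>{1..n}. \<Prod>j\<in>{1..<i}. p j i ^ (lookup a i * lookup b j))"

sublocale quantum_affine_space bichar "{1..n}"
proof -
  interpret skew_monoid_algebra bichar
  proof
    show "bichar (a + b) c = bichar a c * bichar b c" for a b c
      by (simp add: bichar_def lookup_add add_mult_distrib power_add prod.distrib)
    show "bichar a (b + c) = bichar a b * bichar a c" for a b c
      by (simp add: bichar_def lookup_add add_mult_distrib2 power_add prod.distrib)
    show "bichar a b \<noteq> 0" for a b
      using p_nonzero by (auto simp: bichar_def)
  qed
  interpret quantum_space bichar ..
  have "bichar a (restr (\<lambda>i. i \<in> {1..n}) b) = bichar a b" "bichar (restr (\<lambda>i. i \<in> {1..n}) b) a = bichar b a" for a b
    by (auto simp: bichar_def lookup_restr intro!: prod.cong)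
  then show "quantum_affine_space bichar {1..n}"
    by unfold_locales (simp_all add: comm_factor_def)
qed

notation tmul (infixl "\<star>" 70)

lemma bichar_single:
  assumes "i \<in> {1..n}" "j \<in> {1..n}"
  shows "bichar (single i 1) (single j 1) = (if j < i then p j i else 1)"
proof -
  have "bichar (single i 1) (single j 1) =
      (\<Prod>i'\<in>{1..n}. if i' = i then (\<Prod>j'\<in>{1..<i}. if j' = j then p j i else 1) else 1)"
    unfolding bichar_def
  proof (intro prod.cong refl)
    fix i' show "(\<Prod>j'\<in>{1..<i'}. p j' i' ^ (lookup (single i 1) i' * lookup (single j 1) j')) =
        (if i' = i then (\<Prod>j'\<in>{1..<i}. if j' = j then p j i else 1) else 1)"
    proof (cases "i' = i")
      case True
      have "p j' i ^ (lookup (single i 1) i * lookup (single j 1) j') = (if j' = j then p j i else 1)" for j'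
        by (simp add: lookup_single when_def)
      then show ?thesis using True by simp
    next
      case False
      then show ?thesis by (simp add: lookup_single when_def)
    qed
  qed
  also have "\<dots> = (if j < i then p j i else 1)"
    using assms by (simp add: prod.delta)
  finally show ?thesis .
qed

lemma var_relation:
  assumes "i \<in> {1..n}" "j \<in> {1..n}"
  shows "var j \<star> var i = single 0 (p i j) \<star> (var i \<star> var j)"
proof -
  have "bichar (single j 1) (single i 1) = p i j * bichar (single i 1) (single j 1)"
    using assms p_inverse[OF assms] p_diag by (auto simp: bichar_single)
  then show ?thesis by (simp add: tmul_single_single add.commute)
qed

abbreviation free_ring :: "(nat list \<Rightarrow> 'k) ring"
  where "free_ring \<equiv> free_algebra {1..n}"

definition rel_ideal :: "(nat list \<Rightarrow> 'k) set"
  where "rel_ideal = Idl\<^bsub>free_ring\<^esub> (skew_relations n p)"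

lemma skew_relations_eq:
  "skew_relations n p = {(\<lambda>w. word 1 [j, i] w - word (p i j) [i, j] w) |i j. i \<in> {1..n} \<and> j \<in> {1..n}}"
proof -
  have var: "free_var i = word 1 [i]" for i :: nat by (simp add: free_var_def word_def)
  have const: "free_const c = word c []" for c by (simp add: free_const_def word_def)
  have "free_var j \<otimes>\<^bsub>free_ring\<^esub> free_var i \<ominus>\<^bsub>free_ring\<^esub>
      free_const (p i j) \<otimes>\<^bsub>free_ring\<^esub> (free_var i \<otimes>\<^bsub>free_ring\<^esub> free_var j)
      = (\<lambda>w. word 1 [j, i] w - word (p i j) [i, j] w)" if "i \<in> {1..n}" "j \<in> {1..n}" for i j
    unfolding var const word_mult using that by (subst free_minus) (auto intro!: word_closed)
  then show ?thesis unfolding skew_relations_def Let_def by (intro Collect_cong ex_cong1) auto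
qed

lemma ideal_rel_ideal: "ideal rel_ideal free_ring"
  and relations_subset: "skew_relations n p \<subseteq> rel_ideal"
proof -
  interpret ring free_ring by (rule ring_free_algebra)
  have "skew_relations n p \<subseteq> carrier free_ring"
  proof
    fix f assume "f \<in> skew_relations n p"
    then obtain i j where ij: "i \<in> {1..n}" "j \<in> {1..n}" "f = (\<lambda>w. word 1 [j, i] w - word (p i j) [i, j] w)"
      unfolding skew_relations_eq by blast
    then have "f = word 1 [j, i] \<ominus>\<^bsub>free_ring\<^esub> word (p i j) [i, j]"
      by (subst free_minus) (auto intro!: word_closed)
    then show "f \<in> carrier free_ring"
      using ij by (simp add: minus_closed word_closed)
  qed
  then show "ideal rel_ideal free_ring" "skew_relations n p \<subseteq> rel_ideal"
    unfolding rel_ideal_def by (rule genideal_ideal, rule genideal_self)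
qed

definition cong_rel :: "(nat list \<Rightarrow> 'k) \<Rightarrow> (nat list \<Rightarrow> 'k) \<Rightarrow> bool" (infix "\<approx>" 50)
  where "f \<approx> g \<longleftrightarrow> f \<in> carrier free_ring \<and> g \<in> carrier free_ring \<and> f \<ominus>\<^bsub>free_ring\<^esub> g \<in> rel_ideal"

lemma cong_rel_refl: "f \<in> carrier free_ring \<Longrightarrow> f \<approx> f"
proof -
  interpret ideal rel_ideal free_ring by (rule ideal_rel_ideal)
  assume f: "f \<in> carrier free_ring"
  then have "f \<ominus>\<^bsub>free_ring\<^esub> f = \<zero>\<^bsub>free_ring\<^esub>" using r_right_minus_eq by blast
  then show ?thesis
    using f additive_subgroup.zero_closed[OF is_additive_subgroup] unfolding cong_rel_def by metis
qed

lemma cong_rel_trans: "f \<approx> g \<Longrightarrow> g \<approx> h \<Longrightarrow> f \<approx> h"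
proof -
  interpret ideal rel_ideal free_ring by (rule ideal_rel_ideal)
  assume fg: "f \<approx> g" "g \<approx> h"
  then have "f \<ominus>\<^bsub>free_ring\<^esub> h = (f \<ominus>\<^bsub>free_ring\<^esub> g) \<oplus>\<^bsub>free_ring\<^esub> (g \<ominus>\<^bsub>free_ring\<^esub> h)"
    unfolding cong_rel_def by (simp add: free_minus free_algebra_simps(5))
  then show ?thesis
    using fg additive_subgroup.a_closed[OF is_additive_subgroup] unfolding cong_rel_def by metis
qed

lemma cong_rel_add:
  assumes "f \<approx> g" "f' \<approx> g'"
  shows "f \<oplus>\<^bsub>free_ring\<^esub> f' \<approx> g \<oplus>\<^bsub>free_ring\<^esub> g'"
proof -
  interpret ideal rel_ideal free_ring by (rule ideal_rel_ideal)
  have closed: "f \<oplus>\<^bsub>free_ring\<^esub> f' \<in> carrier free_ring" "g \<oplus>\<^bsub>free_ring\<^esub> g' \<in> carrier free_ring"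
    using assms unfolding cong_rel_def by (blast intro: add.m_closed)+
  have "(f \<oplus>\<^bsub>free_ring\<^esub> f') \<ominus>\<^bsub>free_ring\<^esub> (g \<oplus>\<^bsub>free_ring\<^esub> g') =
      (f \<ominus>\<^bsub>free_ring\<^esub> g) \<oplus>\<^bsub>free_ring\<^esub> (f' \<ominus>\<^bsub>free_ring\<^esub> g')"
    using assms closed unfolding cong_rel_def by (simp add: free_minus free_algebra_simps(5) algebra_simps)
  then show ?thesis
    using assms closed additive_subgroup.a_closed[OF is_additive_subgroup] unfolding cong_rel_def by metis
qed

lemma cong_rel_mult_left:
  assumes "f \<approx> g" "h \<in> carrier free_ring"
  shows "h \<otimes>\<^bsub>free_ring\<^esub> f \<approx> h \<otimes>\<^bsub>free_ring\<^esub> g"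
proof -
  interpret ideal rel_ideal free_ring by (rule ideal_rel_ideal)
  have "h \<otimes>\<^bsub>free_ring\<^esub> f \<ominus>\<^bsub>free_ring\<^esub> h \<otimes>\<^bsub>free_ring\<^esub> g = h \<otimes>\<^bsub>free_ring\<^esub> (f \<ominus>\<^bsub>free_ring\<^esub> g)"
    using assms unfolding cong_rel_def by (simp only: r_distr a_minus_def a_inv_closed r_minus)
  then show ?thesis using assms I_l_closed[of "f \<ominus>\<^bsub>free_ring\<^esub> g" h] m_closed unfolding cong_rel_def by metis
qed

lemma cong_rel_mult_right:
  assumes "f \<approx> g" "h \<in> carrier free_ring"
  shows "f \<otimes>\<^bsub>free_ring\<^esub> h \<approx> g \<otimes>\<^bsub>free_ring\<^esub> h"
proof -
  interpret ideal rel_ideal free_ring by (rule ideal_rel_ideal)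
  have "f \<otimes>\<^bsub>free_ring\<^esub> h \<ominus>\<^bsub>free_ring\<^esub> g \<otimes>\<^bsub>free_ring\<^esub> h = (f \<ominus>\<^bsub>free_ring\<^esub> g) \<otimes>\<^bsub>free_ring\<^esub> h"
    using assms unfolding cong_rel_def by (simp only: l_distr a_minus_def a_inv_closed l_minus)
  then show ?thesis using assms I_r_closed[of "f \<ominus>\<^bsub>free_ring\<^esub> g" h] m_closed unfolding cong_rel_def by metis
qed

text \<open>
  A defining relation, multiplied on the right by the word \<open>u\<close>.
\<close>
lemma word_swap:
  assumes "x \<in> {1..n}" "y \<in> {1..n}" "u \<in> lists {1..n}"
  shows "word c (x # y # u) \<approx> word (c * p y x) (y # x # u)"
proof -
  have xy: "word 1 [x, y] \<in> carrier free_ring" "word (p y x) [y, x] \<in> carrier free_ring"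
    using assms by (auto intro!: word_closed)
  have "word 1 [x, y] \<ominus>\<^bsub>free_ring\<^esub> word (p y x) [y, x] \<in> skew_relations n p"
    unfolding free_minus[OF xy] skew_relations_eq using assms by blast
  then have "word 1 [x, y] \<approx> word (p y x) [y, x]"
    unfolding cong_rel_def using xy relations_subset by blast
  then have "word 1 [x, y] \<otimes>\<^bsub>free_ring\<^esub> word c u \<approx> word (p y x) [y, x] \<otimes>\<^bsub>free_ring\<^esub> word c u"
    by (rule cong_rel_mult_right) (intro word_closed assms)
  then show ?thesis by (simp add: word_mult mult.commute)
qed

lemma word_insort:
  assumes "x \<in> {1..n}" "u \<in> lists {1..n}"
  shows "\<exists>d. word c (x # u) \<approx> word d (insort x u)"
  using assms
proof (induction u arbitrary: c)
  case Nil
  then show ?case by (auto intro!: exI[of _ c] cong_rel_refl word_closed)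
next
  case (Cons y u)
  show ?case
  proof (cases "x \<le> y")
    case True
    then show ?thesis using Cons.prems
      by (auto intro!: exI[of _ c] cong_rel_refl word_closed)
  next
    case False
    have "x \<in> {1..n}" "u \<in> lists {1..n}" using Cons.prems by simp_all
    then obtain d where d: "word (c * p y x) (x # u) \<approx> word d (insort x u)"
      using Cons.IH[of "c * p y x"] by blast
    have "word 1 [y] \<otimes>\<^bsub>free_ring\<^esub> word (c * p y x) (x # u) \<approx> word 1 [y] \<otimes>\<^bsub>free_ring\<^esub> word d (insort x u)"
      using d Cons.prems by (intro cong_rel_mult_left word_closed) auto
    then have "word (c * p y x) (y # x # u) \<approx> word d (y # insort x u)"
      by (simp add: word_mult)
    then have "word c (x # y # u) \<approx> word d (y # insort x u)"
      using word_swap[of x y u c] cong_rel_trans Cons.prems by auto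
    then show ?thesis using False by auto
  qed
qed

lemma word_sort:
  assumes "u \<in> lists {1..n}"
  shows "\<exists>d. word c u \<approx> word d (sort u)"
  using assms
proof (induction u arbitrary: c rule: list.induct)
  case Nil
  then show ?case by (auto intro!: exI[of _ c] cong_rel_refl word_closed)
next
  case (Cons x u)
  have "u \<in> lists {1..n}" using Cons.prems by simp
  then obtain d where d: "word c u \<approx> word d (sort u)" using Cons.IH[of c] by blast
  have "word 1 [x] \<otimes>\<^bsub>free_ring\<^esub> word c u \<approx> word 1 [x] \<otimes>\<^bsub>free_ring\<^esub> word d (sort u)"
    using d Cons.prems by (intro cong_rel_mult_left word_closed) auto
  then have "word c (x # u) \<approx> word d (x # sort u)" by (simp add: word_mult)
  moreover obtain e where "word d (x # sort u) \<approx> word e (insort x (sort u))"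
    using word_insort[of x "sort u" d] Cons.prems by (auto simp: in_lists_conv_set)
  ultimately show ?case using cong_rel_trans by auto
qed

text \<open>
  Sorting a word by adjacent transpositions changes it, modulo the relations, by a scalar only.
\<close>
lemma sorted_normal_form:
  assumes "f \<in> carrier free_ring"
  shows "\<exists>g. f \<approx> g \<and> (\<forall>w. g w \<noteq> 0 \<longrightarrow> sorted w)"
proof -
  interpret ring free_ring by (rule ring_free_algebra)
  have "\<exists>g. f \<approx> g \<and> (\<forall>w. g w \<noteq> 0 \<longrightarrow> sorted w)"
    if "finite A" "A \<subseteq> lists {1..n}" "{w. f w \<noteq> 0} \<subseteq> A" for A and f :: "nat list \<Rightarrow> 'k"
    using that
  proof (induction A arbitrary: f rule: finite_induct)
    case empty
    then have "f = \<zero>\<^bsub>free_ring\<^esub>" by (auto simp: free_algebra_simps)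
    moreover have "\<zero>\<^bsub>free_ring\<^esub> w = 0" for w by (simp add: free_algebra_simps)
    ultimately show ?case using cong_rel_refl[OF zero_closed] by metis
  next
    case (insert u A)
    define f' where "f' = (\<lambda>w. if w = u then 0 else f w)"
    have "{w. f' w \<noteq> 0} \<subseteq> A" using insert.prems by (auto simp: f'_def)
    then obtain g where g: "f' \<approx> g" "\<And>w. g w \<noteq> 0 \<Longrightarrow> sorted w" using insert by blast
    obtain d where d: "word (f u) u \<approx> word d (sort u)" using word_sort[of u "f u"] insert.prems by blast
    have "f = f' \<oplus>\<^bsub>free_ring\<^esub> word (f u) u" by (auto simp: f'_def word_def free_algebra_simps)
    then have "f \<approx> g \<oplus>\<^bsub>free_ring\<^esub> word d (sort u)" using cong_rel_add[OF g(1) d] by simp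
    moreover have "sorted w" if "(g \<oplus>\<^bsub>free_ring\<^esub> word d (sort u)) w \<noteq> 0" for w
      using that g(2)[of w] by (auto simp: word_def free_algebra_simps split: if_splits)
    ultimately show ?case by blast
  qed
  then show ?thesis using assms by (auto simp: free_algebra_simps)
qed

text \<open>
  Modulo the relations an element of the kernel is a combination of sorted words, and this
  combination lies in the kernel as well. Linear independence of the sorted words makes it zero.
\<close>
lemma eval_words_kernel: "a_kernel free_ring (qring {1..n}) eval_words = rel_ideal"
proof
  interpret F: ring free_ring by (rule ring_free_algebra)
  interpret ev: ring_hom_ring free_ring "qring {1..n}" eval_words
    using ring_free_algebra ring_qring eval_words_hom by (rule ring_hom_ringI2)
  show sub: "rel_ideal \<subseteq> a_kernel free_ring (qring {1..n}) eval_words"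
    unfolding rel_ideal_def
  proof (rule F.genideal_minimal[OF ev.kernel_is_ideal], rule subsetI)
    fix f assume f: "f \<in> skew_relations n p"
    then obtain i j where ij: "i \<in> {1..n}" "j \<in> {1..n}" "f = (\<lambda>w. word 1 [j, i] w - word (p i j) [i, j] w)"
      unfolding skew_relations_eq by blast
    have closed: "word 1 [j, i] \<in> carrier free_ring" "word (- p i j) [i, j] \<in> carrier free_ring"
      using ij by (auto intro!: word_closed)
    have "f = (\<lambda>w. word 1 [j, i] w + word (- p i j) [i, j] w)" using ij(3) by (auto simp: word_def)
    then have "eval_words f = eval_words (word 1 [j, i]) + eval_words (word (- p i j) [i, j])"
      using eval_words_add[OF closed] by simp
    also have "\<dots> = var j \<star> var i - single 0 (p i j) \<star> (var i \<star> var j)"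
      by (simp add: eval_word single_uminus tmul_uminus_left)
    finally have "eval_words f = 0" by (simp only: var_relation[OF ij(1,2)] diff_self)
    moreover have "f \<in> carrier free_ring"
      using f relations_subset ideal_rel_ideal by (meson additive_subgroup.a_Hcarr ideal.axioms(1) subsetD)
    ultimately show "f \<in> a_kernel free_ring (qring {1..n}) eval_words"
      by (simp only: a_kernel_def' mem_Collect_eq qring_simps)
  qed
  show "a_kernel free_ring (qring {1..n}) eval_words \<subseteq> rel_ideal"
  proof
    fix f assume "f \<in> a_kernel free_ring (qring {1..n}) eval_words"
    then have f: "f \<in> carrier free_ring" "eval_words f = 0"
      by (simp_all only: a_kernel_def' mem_Collect_eq qring_simps)
    obtain g where g: "f \<approx> g" "\<And>w. g w \<noteq> 0 \<Longrightarrow> sorted w" using sorted_normal_form[OF f(1)] by blast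
    have gF: "g \<in> carrier free_ring" and fg: "f \<ominus>\<^bsub>free_ring\<^esub> g \<in> rel_ideal" using g by (auto simp only: cong_rel_def)
    have "eval_words (f \<ominus>\<^bsub>free_ring\<^esub> g) = 0"
      using fg sub by (auto simp only: a_kernel_def' qring_simps)
    moreover have "(\<lambda>w. (f \<ominus>\<^bsub>free_ring\<^esub> g) w + g w) = f"
      unfolding free_minus[OF f(1) gF] by simp
    ultimately have "eval_words f = 0 + eval_words g"
      using eval_words_add[OF F.minus_closed[OF f(1) gF] gF] by simp
    then have "g w = 0" for w
      using eval_words_kernel_sorted[of g w] g(2) gF f(2) by (simp add: free_algebra_simps)
    then have "f \<ominus>\<^bsub>free_ring\<^esub> g = f" unfolding free_minus[OF f(1) gF] by simp
    then show "f \<in> rel_ideal" using fg by simp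
  qed
qed

theorem noetherian_UFR_skew_polynomial_ring: "noetherian_UFR (skew_polynomial_ring n p)"
proof -
  interpret ev: ring_hom_ring free_ring "qring {1..n}" eval_words
    using ring_free_algebra ring_qring eval_words_hom by (rule ring_hom_ringI2)
  have quot: "skew_polynomial_ring n p = free_ring Quot rel_ideal"
    by (simp add: skew_polynomial_ring_def rel_ideal_def Let_def)
  have "(\<lambda>X. the_elem (eval_words ` X)) \<in> ring_iso (free_ring Quot rel_ideal) (qring {1..n})"
    using ev.FactRing_iso_set[OF eval_words_surj] by (simp only: eval_words_kernel)
  then show ?thesis
    unfolding quot
    by (rule noetherian_UFR_iso[OF ideal.quotient_is_ring[OF ideal_rel_ideal] ring_qring _ noetherian_UFR_qring])
qed

end

theorem proposition1p4:
  fixes n :: nat and p :: "nat \<Rightarrow> nat \<Rightarrow> 'k::field"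
  assumes "n \<ge> 1"
    and "\<And>i j. \<lbrakk>i \<in> {1..n}; j \<in> {1..n}\<rbrakk> \<Longrightarrow> p i j \<noteq> 0"
    and "\<And>i j. \<lbrakk>i \<in> {1..n}; j \<in> {1..n}\<rbrakk> \<Longrightarrow> p i j * p j i = 1"
    and "\<And>i. i \<in> {1..n} \<Longrightarrow> p i i = 1"
  shows "noetherian_UFR (skew_polynomial_ring n p)"
proof -
  interpret skew_parameters n p by unfold_locales (use assms in auto)
  show ?thesis by (rule noetherian_UFR_skew_polynomial_ring)
qed

end
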